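(* For every $n\ge 3$, the Whitehouse complex $\Delta_n$ is homotopy equivalent to a wedge of $(n-2)!$ spheres of dimension $n-4$.
   Context: The Whitehouse complex $\Delta_n$ ($n\ge 3$) is the simplicial complex with vertex set $V_n=\{S\subseteq\{2,\dots,n\}: 2\le |S|\le n-2\}$, in which a subset $F\subseteq V_n$ is a face iff for all $S,T\in F$ one has $S\subseteq T$, $T\subseteq S$, or $S\cap T=\emptyset$. Convention: $\Delta_3=\{\emptyset\}$ is regarded as the $(-1)$-dimensional sphere (a wedge of one $(-1)$-sphere). *)

theory Defs
  imports "HOL-Analysis.Analysis"
begin

text \<open>Geometric realization of a finite abstract simplicial complex with vertex set V and
  set of faces K (each face a subset of V, K closed under subsets, containing the empty face):
  the points are the functions f : V -> [0,1] with coordinate sum 1 whose support is a face,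
  topologized as a subspace of the product R^V.\<close>
definition geometric_realization :: "'a set \<Rightarrow> 'a set set \<Rightarrow> ('a \<Rightarrow> real) topology" where
  "geometric_realization V K =
     subtopology (powertop_real V)
       {f. f \<in> extensional V \<and> (\<forall>v\<in>V. 0 \<le> f v) \<and> sum f V = 1 \<and> {v\<in>V. f v \<noteq> 0} \<in> K}"

definition whitehouse_vertices :: "nat \<Rightarrow> nat set set" where
  "whitehouse_vertices n = {S. S \<subseteq> {2..n} \<and> 2 \<le> card S \<and> card S \<le> n - 2}"

definition whitehouse_faces :: "nat \<Rightarrow> nat set set set" where
  "whitehouse_faces n = {F. F \<subseteq> whitehouse_vertices n \<and>
      (\<forall>S\<in>F. \<forall>T\<in>F. S \<subseteq> T \<or> T \<subseteq> S \<or> S \<inter> T = {})}"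

text \<open>A wedge of m spheres of dimension d: for d >= 0 the union of m round d-spheres
  living in pairwise orthogonal (d+1)-dimensional coordinate blocks, each of radius 1 and
  centred at the first unit vector of its block, so that they meet exactly in the origin
  (the base point). For d < 0 (the (-1)-sphere convention) it is the empty space.\<close>
definition wedge_of_spheres :: "nat \<Rightarrow> int \<Rightarrow> (nat \<times> nat \<Rightarrow> real) topology" where
  "wedge_of_spheres m d =
     (if d < 0 then subtopology (powertop_real UNIV) {}
      else subtopology (powertop_real UNIV)
        (insert (\<lambda>_. 0)
          (\<Union>k<m. {x. (\<forall>i j. x (i, j) \<noteq> 0 \<longrightarrow> i = k \<and> j \<le> nat d) \<and>
                      (x (k, 0) - 1)\<^sup>2 + (\<Sum>j\<in>{1..nat d}. (x (k, j))\<^sup>2) = 1})))"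

end

theory Submission
  imports Defs "HOL-Combinatorics.Multiset_Permutations"
begin

text \<open>For \<open>n \<ge> 4\<close> call a face full if it contains a flag
  \<open>{2, b\<^sub>1} \<subset> {2, b\<^sub>1, b\<^sub>2} \<subset> \<dots> \<subset> {2, b\<^sub>1, \<dots>, b\<^sub>n\<^sub>-\<^sub>3}\<close>. A full face equals this
  flag and is a facet with \<open>n - 3\<close> vertices, and the flags correspond to the \<open>(n - 2)!\<close> orderings of
  \<open>{3..n}\<close>. The other faces form a contractible subcomplex: in a face that is not full, take the first
  gap in the chain of its members containing \<open>2\<close>, and add or remove the difference of the two sets
  around the gap. This is an acyclic matching of all the remaining faces, the empty face included.
  Since the complement of the open full facets is contractible, collapsing it to a point is a homotopy
  equivalence, and the quotient is a wedge of \<open>(n - 2)!\<close> spheres of dimension \<open>n - 4\<close>.\<close>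

section \<open>Geometric realizations\<close>

text \<open>The element \<open>2\<close> is one arbitrary point of \<open>{2..n}\<close>. Two
  members of a face that contain it cannot be disjoint, so they form a chain. The vertex that the
  matching adds or removes depends on this chain only and avoids \<open>2\<close>, so adding it
  leaves the chain unchanged. This is the source of acyclicity, and it lets all pairs with equally
  long chains be collapsed at once by moving mass inside simplices. The obstacle is that the target
  is a concrete set of real families and not an abstract quotient. The quotient is therefore
  realized by an explicit continuous map onto the round spheres that identifies points of the
  contractible part only; from a compact to a Hausdorff space, this map and its product with the
  time interval are quotient maps. A sphere through the origin is the image of a hyperplane under
  inversion (up to the origin itself), which is why the map has a rational formula. The collapse
  also asks for a contraction of the subcomplex that extends to the whole realization; the extension
  is written down with a collar in every facet.\<close>

definition supp :: "'a set \<Rightarrow> ('a \<Rightarrow> real) \<Rightarrow> 'a set" where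
  "supp V f = {v \<in> V. f v \<noteq> 0}"

lemma topspace_geometric_realization:
  "topspace (geometric_realization V K) =
     {f \<in> extensional V. (\<forall>v\<in>V. 0 \<le> f v) \<and> sum f V = 1 \<and> supp V f \<in> K}"
  by (auto simp: geometric_realization_def supp_def PiE_def)

lemma continuous_map_coordinate:
  assumes "v \<in> V"
  shows "continuous_map (geometric_realization V K) euclideanreal (\<lambda>f. f v)"
  unfolding geometric_realization_def
  using assms by (intro continuous_map_from_subtopology continuous_map_product_projection)

lemma continuous_map_into_geometric_realization:
  assumes "\<And>v. v \<in> V \<Longrightarrow> continuous_map X euclideanreal (\<lambda>x. f x v)"
    and "\<And>x. x \<in> topspace X \<Longrightarrow> f x \<in> topspace (geometric_realization V K)"
  shows "continuous_map X (geometric_realization V K) f"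
proof -
  have "f x i = undefined" if "i \<notin> V" "x \<in> topspace X" for i x
    using assms(2)[OF that(2)] that(1) by (auto simp: topspace_geometric_realization extensional_def)
  then have "continuous_map X (powertop_real V) f"
    using assms(1) by (intro continuous_map_coordinatewise_then_product) auto
  then show ?thesis
    unfolding geometric_realization_def
    using assms(2) by (intro continuous_map_into_subtopology)
      (auto simp: topspace_geometric_realization supp_def)
qed

lemma continuous_map_Min_image:
  assumes "finite S" "S \<noteq> {}" "\<And>v. v \<in> S \<Longrightarrow> continuous_map X euclideanreal (\<lambda>x. f x v)"
  shows "continuous_map X euclideanreal (\<lambda>x. Min (f x ` S))"
  using assms
proof (induction S rule: finite_ne_induct)
  case (insert v S)
  then have "(\<lambda>x. Min (f x ` insert v S)) = (\<lambda>x. min (f x v) (Min (f x ` S)))"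
    by simp
  with insert show ?case
    by (simp add: continuous_map_real_min)
qed auto

locale finite_complex =
  fixes V :: "'a set" and K :: "'a set set"
  assumes finite_vertices: "finite V"
    and face_subset: "F \<in> K \<Longrightarrow> F \<subseteq> V"
    and face_closed: "F \<in> K \<Longrightarrow> G \<subseteq> F \<Longrightarrow> G \<in> K"
begin

lemma finite_face: "F \<in> K \<Longrightarrow> finite F"
  using face_subset finite_vertices finite_subset by blast

lemma finite_faces: "finite K"
  using face_subset finite_vertices by (meson Pow_iff finite_Pow_iff finite_subset subsetI)

text \<open>Points of the segment from \<open>f x\<close> to \<open>g x\<close> are supported on the
  union of the two supports; once that union is a face, the segment stays in the
  realization.\<close>

lemma homotopic_straight_line:
  assumes f: "continuous_map X (geometric_realization V K) f"
    and g: "continuous_map X (geometric_realization V K) g"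
    and K: "\<And>x. x \<in> topspace X \<Longrightarrow> supp V (f x) \<union> supp V (g x) \<in> K"
  shows "homotopic_with (\<lambda>_. True) X (geometric_realization V K) f g"
proof -
  define h where "h = (\<lambda>(t, x). \<lambda>v\<in>V. (1 - t) * f x v + t * g x v)"
  let ?P = "prod_topology (top_of_set {0..1::real}) X"
  have fg: "f x \<in> topspace (geometric_realization V K)" "g x \<in> topspace (geometric_realization V K)" if "x \<in> topspace X" for x
    using that f g by (auto simp: continuous_map_def)
  have "continuous_map ?P (geometric_realization V K) h"
  proof (rule continuous_map_into_geometric_realization)
    fix v assume v: "v \<in> V"
    have t: "continuous_map ?P euclideanreal fst"
      by (metis continuous_map_fst continuous_map_into_fulltopology)
    have c: "continuous_map ?P euclideanreal (\<lambda>p. f (snd p) v)"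
            "continuous_map ?P euclideanreal (\<lambda>p. g (snd p) v)"
      using continuous_map_compose[OF continuous_map_compose[OF continuous_map_snd f] continuous_map_coordinate[OF v]]
        continuous_map_compose[OF continuous_map_compose[OF continuous_map_snd g] continuous_map_coordinate[OF v]]
      by (auto simp: o_def)
    have "continuous_map ?P euclideanreal (\<lambda>p. (1 - fst p) * f (snd p) v + fst p * g (snd p) v)"
      by (intro continuous_intros t c) auto
    then show "continuous_map ?P euclideanreal (\<lambda>p. h p v)"
      using v by (simp add: h_def case_prod_unfold)
  next
    fix p assume "p \<in> topspace ?P"
    then obtain t x where p: "p = (t, x)" "0 \<le> t" "t \<le> 1" "x \<in> topspace X"
      by (cases p) auto
    note F = fg[OF p(4), unfolded topspace_geometric_realization, simplified]
    have "sum (h p) V = (1 - t) * sum (f x) V + t * sum (g x) V"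
      by (simp add: h_def p sum.distrib sum_distrib_left)
    moreover have "supp V (h p) \<subseteq> supp V (f x) \<union> supp V (g x)"
      by (auto simp: h_def p supp_def)
    then have "supp V (h p) \<in> K"
      using K[OF p(4)] face_closed by blast
    ultimately show "h p \<in> topspace (geometric_realization V K)"
      using F p by (auto simp: topspace_geometric_realization h_def)
  qed
  moreover have "h (0, x) = f x" "h (1, x) = g x" if "x \<in> topspace X" for x
    using fg[OF that] by (auto simp: h_def topspace_geometric_realization extensional_def)
  ultimately show ?thesis
    by (subst homotopic_with) (auto intro!: exI[of _ h])
qed

text \<open>The realization is a closed subset of the cube over \<open>V\<close>. The support
  condition is closed because \<open>K\<close> is closed under subsets: the support is a face iff
  \<open>f\<close> vanishes off some face \<open>F\<close>, and there are finitely many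
  \<open>F\<close>.\<close>

lemma compact_space_realization: "compact_space (geometric_realization V K)"
proof -
  let ?P = "powertop_real V"
  let ?T = "topspace (geometric_realization V K)"
  let ?A = "\<Pi>\<^sub>E v\<in>V. {0..1::real}"
  let ?B = "{f \<in> topspace ?P. sum f V \<in> {1}}"
  let ?C = "\<Union>F\<in>K. {f \<in> topspace ?P. sum f (V - F) \<in> {0}}"
  have sumc: "continuous_map ?P euclideanreal (\<lambda>f. sum f S)" if "S \<subseteq> V" for S
    using that finite_vertices
    by (intro continuous_map_sum continuous_map_product_projection) (auto intro: finite_subset)
  have sumcl: "closedin ?P {f \<in> topspace ?P. sum f S \<in> {x}}" if "S \<subseteq> V" for S x
    by (rule closedin_continuous_map_preimage[OF sumc[OF that]]) simp
  have eq: "?T = ?A \<inter> (?B \<inter> ?C)"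
  proof (intro set_eqI iffI)
    fix f assume f: "f \<in> ?T"
    then have nn: "\<And>v. v \<in> V \<Longrightarrow> 0 \<le> f v" and s: "sum f V = 1"
      and e: "f \<in> extensional V" and K: "supp V f \<in> K"
      by (auto simp: topspace_geometric_realization)
    have "f v \<le> 1" if "v \<in> V" for v
      using member_le_sum[of v V f] that nn s finite_vertices by auto
    moreover have "sum f (V - supp V f) = 0"
      by (intro sum.neutral) (auto simp: supp_def)
    ultimately show "f \<in> ?A \<inter> (?B \<inter> ?C)"
      using nn s e K by (auto simp: PiE_def)
  next
    fix f assume f: "f \<in> ?A \<inter> (?B \<inter> ?C)"
    then obtain F where F: "F \<in> K" "sum f (V - F) = 0" by auto
    have nn: "\<And>v. v \<in> V \<Longrightarrow> 0 \<le> f v" using f by (auto simp: PiE_def Pi_def)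
    then have "\<forall>v\<in>V - F. f v = 0"
      using F finite_vertices by (subst (asm) sum_nonneg_eq_0_iff) auto
    then have "supp V f \<subseteq> F"
      by (auto simp: supp_def)
    then have "supp V f \<in> K"
      by (rule face_closed[OF F(1)])
    then show "f \<in> ?T"
      using f nn by (auto simp: topspace_geometric_realization PiE_def)
  qed
  have "compactin ?P ?A"
    by (simp add: compactin_PiE)
  moreover have "closedin ?P (?B \<inter> ?C)"
    by (intro closedin_Int closedin_Union finite_imageI finite_faces sumcl)
      (use sumcl[OF Diff_subset] in blast)+
  ultimately have "compactin ?P ?T"
    unfolding eq by (rule compact_Int_closedin)
  moreover have "geometric_realization V K = subtopology ?P ?T"
    unfolding geometric_realization_def by (metis subtopology_restrict topspace_subtopology)
  ultimately show ?thesis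
    by (metis compact_space_subtopology)
qed

end

text \<open>A continuous test for whether all of \<open>c\<close> lies in the support: a minimum of
  non-negative numbers is non-zero iff each of them is.\<close>

lemma (in finite_complex) Min_face_pos:
  assumes f: "f \<in> topspace (geometric_realization V K)" and c: "finite c" "c \<noteq> {}" "c \<subseteq> V"
  shows "0 \<le> Min (f ` c)" "Min (f ` c) \<noteq> 0 \<longleftrightarrow> c \<subseteq> supp V f"
proof -
  have nn: "\<And>v. v \<in> V \<Longrightarrow> 0 \<le> f v"
    using f by (auto simp: topspace_geometric_realization)
  then show "0 \<le> Min (f ` c)"
    using c by auto
  have "0 < Min (f ` c) \<longleftrightarrow> (\<forall>v\<in>c. 0 < f v)"
    using c by auto
  also have "\<dots> \<longleftrightarrow> c \<subseteq> supp V f"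
    using nn c by (fastforce simp: supp_def less_le)
  finally show "Min (f ` c) \<noteq> 0 \<longleftrightarrow> c \<subseteq> supp V f"
    using \<open>0 \<le> Min (f ` c)\<close> by linarith
qed

lemma (in finite_complex) realization_nonempty:
  assumes "{w} \<in> K"
  shows "topspace (geometric_realization V K) \<noteq> {}"
proof -
  have "w \<in> V" using face_subset[OF assms] by simp
  moreover from this have "supp V (\<lambda>v\<in>V. if v = w then 1 else 0) = {w}"
    by (auto simp: supp_def)
  ultimately have "(\<lambda>v\<in>V. if v = w then 1 else 0) \<in> topspace (geometric_realization V K)"
    using assms finite_vertices by (simp add: topspace_geometric_realization)
  then show ?thesis by blast
qed

text \<open>Collapse along the matching \<open>F \<leftrightarrow> F \<triangle> {q (F \<inter> A)}\<close>: for the maximal remaining parts \<open>c\<close>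
  inside \<open>A\<close>, move the mass \<open>Min (f ` c)\<close> from every vertex of \<open>c\<close> to \<open>q c\<close>.\<close>

lemma (in finite_complex) contractible_by_matching:
  assumes q: "\<And>F. F \<in> K \<Longrightarrow> insert (q (F \<inter> A)) F \<in> K"
    and qA: "\<And>F. F \<in> K \<Longrightarrow> q (F \<inter> A) \<notin> A"
    and ne: "{} \<in> K"
  shows "contractible_space (geometric_realization V K)"
proof -
  \<comment> \<open>Filtration by the number of vertices in \<open>A\<close>. The partner
    \<open>q (F \<inter> A)\<close> lies outside \<open>A\<close>, so adding it changes neither this
    number nor the partner itself; the matching respects every level.\<close>
  define L where "L k = {F \<in> K. card (F \<inter> A) \<le> k}" for k
  have L: "finite_complex V (L k)" for k
  proof
    fix F G assume F: "F \<in> L k" "G \<subseteq> F"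
    then have "card (G \<inter> A) \<le> card (F \<inter> A)"
      by (intro card_mono) (auto simp: L_def dest: finite_face)
    with F show "G \<in> L k"
      using face_closed by (auto simp: L_def)
  qed (use finite_vertices face_subset in \<open>auto simp: L_def\<close>)
  have qV: "q (F \<inter> A) \<in> V" if "F \<in> K" for F
    using q[OF that] face_subset by blast
  have qL: "insert (q (F \<inter> A)) F \<in> L k" if "F \<in> L k" for F k
    using that q qA by (auto simp: L_def)
  have "contractible_space (geometric_realization V (L k))" for k
  proof (induction k)
    case 0
    interpret finite_complex V "L 0" by (rule L)
    \<comment> \<open>Faces in \<open>L 0\<close> avoid \<open>A\<close> and all have the partner
      \<open>q {}\<close>, so \<open>L 0\<close> is a cone and \<open>p\<close> is its apex.\<close>
    define p where "p = (\<lambda>v\<in>V. if v = q {} then 1 else (0::real))"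
    have FA: "F \<inter> A = {}" if "F \<in> L 0" for F
      using that finite_face[OF that] by (auto simp: L_def)
    have sp: "supp V p = {q {}}"
      using qV[OF ne] by (auto simp: supp_def p_def)
    have "{q {}} \<in> L 0"
      using qL[of "{}" 0] ne by (simp add: L_def)
    then have p: "p \<in> topspace (geometric_realization V (L 0))"
      using qV[OF ne] finite_vertices sp by (auto simp: topspace_geometric_realization p_def)
    have "homotopic_with (\<lambda>_. True) (geometric_realization V (L 0)) (geometric_realization V (L 0)) id (\<lambda>_. p)"
    proof (rule homotopic_straight_line)
      fix f assume "f \<in> topspace (geometric_realization V (L 0))"
      then have "supp V f \<in> L 0" by (auto simp: topspace_geometric_realization)
      then show "supp V (id f) \<union> supp V p \<in> L 0"
        using qL FA by (metis Un_insert_right id_apply sp sup_bot.right_neutral)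
    qed (use p in auto)
    then show ?case
      by (auto simp: contractible_space_def)
  next
    case (Suc k)
    interpret L: finite_complex V "L (Suc k)" by (rule L)
    interpret M: finite_complex V "L k" by (rule L)
    let ?X = "geometric_realization V (L (Suc k))" and ?Y = "geometric_realization V (L k)"
    define C where "C = {c \<in> K. c \<subseteq> A \<and> card c = Suc k}"
    have finC: "finite C"
      using finite_faces by (simp add: C_def)
    have C: "finite c" "c \<noteq> {}" "c \<subseteq> V" "c \<subseteq> A" "c \<in> K" "card c = Suc k" if "c \<in> C" for c
      using that finite_face face_subset by (auto simp: C_def)
    have qC: "q c \<in> V" "q c \<notin> A" if "c \<in> C" for c
      using qV[OF C(5)[OF that]] qA[OF C(5)[OF that]] C(4)[OF that] by (auto simp: Int_absorb2)
    \<comment> \<open>Every vertex of \<open>c\<close> gives up the minimum of \<open>f\<close> on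
      \<open>c\<close>, and \<open>q c\<close> receives it \<open>Suc k\<close> times, once per
      vertex, so the total mass is kept. At a point of \<open>L (Suc k)\<close> at most one
      \<open>c\<close> contributes; summing over all of them makes continuity evident.\<close>
    define r where "r f = (\<lambda>v\<in>V. f v + (\<Sum>c\<in>C. Min (f ` c) *
        (of_bool (v = q c) * real (Suc k) - of_bool (v \<in> c))))" for f
    have r0: "r f = f" if f: "f \<in> topspace ?Y" for f
    proof -
      have sf: "supp V f \<in> L k" and fX: "f \<in> extensional V"
        using f by (auto simp: topspace_geometric_realization)
      have "Min (f ` c) = 0" if c: "c \<in> C" for c
      proof (rule ccontr)
        assume "Min (f ` c) \<noteq> 0"
        then have "c \<subseteq> supp V f \<inter> A"
          using M.Min_face_pos(2)[OF f C(1-3)[OF c]] C[OF c] by auto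
        then have "card c \<le> card (supp V f \<inter> A)"
          using M.finite_face[OF sf] by (intro card_mono) auto
        with sf C[OF c] show False by (auto simp: L_def)
      qed
      then have "r f v = f v" if "v \<in> V" for v
        using that by (simp add: r_def)
      then show ?thesis
        using fX by (auto simp: r_def extensional_def)
    qed
    have r1: "r f \<in> topspace ?Y \<and> supp V f \<union> supp V (r f) \<in> L (Suc k)" if f: "f \<in> topspace ?X" for f
    proof (cases "f \<in> topspace ?Y")
      case True
      then show ?thesis
        using r0[OF True] f by (auto simp: topspace_geometric_realization)
    next
      case False
      define c where "c = supp V f \<inter> A"
      have sf: "supp V f \<in> L (Suc k)" "supp V f \<notin> L k" and f1: "sum f V = 1" "\<And>v. v \<in> V \<Longrightarrow> 0 \<le> f v"
        using f False by (auto simp: topspace_geometric_realization)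
      then have cC: "c \<in> C"
        using face_closed by (auto simp: L_def C_def c_def)
      note c = C[OF cC]
      have "Min (f ` d) = 0" if d: "d \<in> C" "d \<noteq> c" for d
      proof (rule ccontr)
        assume "Min (f ` d) \<noteq> 0"
        then have "d \<subseteq> c"
          using L.Min_face_pos(2)[OF f C(1-3)[OF d(1)]] C[OF d(1)] by (auto simp: c_def)
        with d c C[OF d(1)] show False
          by (metis card_subset_eq)
      qed
      then have sumC: "(\<Sum>d\<in>C. Min (f ` d) * g d) = Min (f ` c) * g c" for g
        by (simp add: sum.remove[OF finC cC])
      define \<mu> where "\<mu> = Min (f ` c)"
      have rf: "r f v = f v + \<mu> * (of_bool (v = q c) * real (Suc k) - of_bool (v \<in> c))" if "v \<in> V" for v
        using that by (simp add: r_def sumC \<mu>_def)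
      have \<mu>: "0 \<le> \<mu>" "\<And>v. v \<in> c \<Longrightarrow> \<mu> \<le> f v"
        using L.Min_face_pos(1)[OF f c(1-3)] c by (auto simp: \<mu>_def)
      have "\<mu> \<in> f ` c"
        using c by (simp add: \<mu>_def)
      \<comment> \<open>A vertex \<open>w\<close> where the minimum is attained loses all its mass,
        and the new vertex \<open>q c\<close> lies outside \<open>A\<close>: this brings the image
        down to \<open>L k\<close>.\<close>
      then obtain w where w: "w \<in> c" "\<mu> = f w" by auto
      have "(\<Sum>v\<in>V. of_bool (v \<in> c)) = real (Suc k)"
        using c finite_vertices by (simp add: of_bool_def sum.If_cases Int_absorb1 del: of_nat_Suc)
      moreover have "(\<Sum>v\<in>V. of_bool (v = q c)) = (1::real)"
        using qC[OF cC] finite_vertices by (simp add: of_bool_def)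
      ultimately have "(\<Sum>v\<in>V. of_bool (v = q c) * real (Suc k) - of_bool (v \<in> c)) = 0"
        by (simp add: sum_subtractf sum_distrib_right[symmetric] del: of_nat_Suc)
      then have "sum (r f) V = 1"
        using f1 by (simp add: rf sum.distrib sum_distrib_left[symmetric] del: of_nat_Suc cong: sum.cong)
      moreover have "0 \<le> r f v" if "v \<in> V" for v
        using that \<mu> f1(2) qC[OF cC] c by (auto simp: rf)
      moreover have "r f \<in> extensional V" by (simp add: r_def)
      moreover have s1: "supp V (r f) \<subseteq> insert (q c) (supp V f)"
        using c by (auto simp: supp_def rf c_def)
      have ins: "insert (q c) (supp V f) \<in> L (Suc k)"
        using qL[OF sf(1)] by (simp add: c_def)
      have "w \<in> V" "w \<noteq> q c"
        using w c qC[OF cC] by auto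
      then have "r f w = 0"
        using w by (simp add: rf)
      then have "supp V (r f) \<inter> A \<subseteq> c - {w}"
        using s1 qC[OF cC] by (auto simp: c_def supp_def)
      then have "card (supp V (r f) \<inter> A) \<le> card (c - {w})"
        using c by (intro card_mono) auto
      then have "card (supp V (r f) \<inter> A) \<le> k"
        using w c by simp
      then have "supp V (r f) \<in> L k"
        using ins s1 face_closed by (auto simp: L_def)
      moreover have "supp V f \<union> supp V (r f) \<in> L (Suc k)"
        using ins s1 L.face_closed by (metis Un_least subset_insertI)
      ultimately show ?thesis
        by (auto simp: topspace_geometric_realization)
    qed
    have cr: "continuous_map ?X ?Y r"
    proof (rule continuous_map_into_geometric_realization)
      fix v assume v: "v \<in> V"
      have "continuous_map ?X euclideanreal (\<lambda>f. f v + (\<Sum>c\<in>C. Min (f ` c) *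
        (of_bool (v = q c) * real (Suc k) - of_bool (v \<in> c))))"
        using v C by (intro continuous_intros continuous_map_Min_image continuous_map_coordinate finC) auto
      then show "continuous_map ?X euclideanreal (\<lambda>f. r f v)"
        using v by (simp add: r_def)
    qed (use r1 in auto)
    have YX: "topspace ?Y \<subseteq> topspace ?X"
      by (auto simp: topspace_geometric_realization L_def)
    have ci: "continuous_map ?Y ?X id"
      using YX by (intro continuous_map_into_geometric_realization) (auto intro: continuous_map_coordinate)
    have "homotopic_with (\<lambda>_. True) ?X ?X id (id \<circ> r)"
      by (rule L.homotopic_straight_line) (use r1 continuous_map_compose[OF cr ci] in auto)
    moreover have "homotopic_with (\<lambda>_. True) ?Y ?Y (r \<circ> id) id"
      by (rule homotopic_with_equal) (use continuous_map_compose[OF ci cr] r0 in auto)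
    ultimately have "?X homotopy_equivalent_space ?Y"
      unfolding homotopy_equivalent_space_def using cr ci homotopic_with_sym by blast
    then show ?case
      using Suc homotopy_equivalent_space_contractibility by blast
  qed
  moreover have "L (card V) = K"
    using face_subset finite_vertices by (auto simp: L_def intro!: card_mono)
  ultimately show ?thesis by metis
qed

section \<open>Collapsing a contractible subspace\<close>

text \<open>\<open>W\<close> stands for \<open>X / Z\<close>, since a continuous map from a compact
  onto a Hausdorff space is a quotient map. The homotopy inverse is the end of the homotopy
  \<open>G\<close>, which is constant on \<open>Z\<close> and so factors through
  \<open>\<Phi>\<close>. As \<open>G\<close> keeps \<open>Z\<close> in \<open>Z\<close> at all
  times, \<open>G\<close> also descends to a homotopy on \<open>W\<close>.\<close>

lemma homotopy_equivalent_space_by_collapse: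
  assumes X: "compact_space X" and W: "Hausdorff_space W"
    and \<Phi>: "continuous_map X W \<Phi>" "\<Phi> ` topspace X = topspace W"
    and inj: "\<And>x y. \<lbrakk>x \<in> topspace X; y \<in> topspace X; \<Phi> x = \<Phi> y\<rbrakk> \<Longrightarrow> x = y \<or> x \<in> Z \<and> y \<in> Z"
    and col: "\<And>x y. \<lbrakk>x \<in> Z; y \<in> Z\<rbrakk> \<Longrightarrow> \<Phi> x = \<Phi> y"
    and G: "continuous_map (prod_topology (top_of_set {0..1::real}) X) X G"
    and G0: "\<And>x. x \<in> topspace X \<Longrightarrow> G (0, x) = x"
    and GZ: "\<And>t x. \<lbrakk>0 \<le> t; t \<le> 1; x \<in> Z\<rbrakk> \<Longrightarrow> G (t, x) \<in> Z"
    and G1: "\<And>x y. \<lbrakk>x \<in> Z; y \<in> Z\<rbrakk> \<Longrightarrow> G (1, x) = G (1, y)"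
  shows "X homotopy_equivalent_space W"
proof -
  let ?I = "top_of_set {0..1::real}"
  have G1c: "continuous_map X X (\<lambda>x. G (1, x))"
    using continuous_map_compose[OF _ G, of X "\<lambda>x. (1, x)"]
    by (auto simp: o_def continuous_map_paired)
  have "quotient_map X W \<Phi>"
    by (rule continuous_imp_quotient_map[OF \<Phi>(1) X W \<Phi>(2)])
  then obtain \<Psi> where \<Psi>: "continuous_map W X \<Psi>" "\<And>x. x \<in> topspace X \<Longrightarrow> \<Psi> (\<Phi> x) = G (1, x)"
    using quotient_map_lift_exists[OF _ G1c] inj G1 by metis
  have c: "compact_space (prod_topology ?I X)"
    using X by (auto simp: compact_space_prod_topology compact_space_subtopology)
  have h: "Hausdorff_space (prod_topology ?I W)"
    using W by (simp add: Hausdorff_space_prod_topology Hausdorff_space_subtopology)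
  \<comment> \<open>The time interval is compact and Hausdorff, so the same criterion applies to the
    product; homotopies then descend like maps.\<close>
  have "quotient_map (prod_topology ?I X) (prod_topology ?I W) (\<lambda>p. (fst p, \<Phi> (snd p)))"
  proof (rule continuous_imp_quotient_map[OF _ c h])
    show "continuous_map (prod_topology ?I X) (prod_topology ?I W) (\<lambda>p. (fst p, \<Phi> (snd p)))"
      using continuous_map_compose[OF continuous_map_snd \<Phi>(1)]
      by (auto simp: continuous_map_paired o_def intro: continuous_map_fst)
    show "(\<lambda>p. (fst p, \<Phi> (snd p))) ` topspace (prod_topology ?I X) = topspace (prod_topology ?I W)"
      using \<Phi>(2) by (force simp: image_iff)
  qed
  moreover have c\<Phi>G: "continuous_map (prod_topology ?I X) W (\<Phi> \<circ> G)"
    by (rule continuous_map_compose[OF G \<Phi>(1)])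
  moreover have "(\<Phi> \<circ> G) p = (\<Phi> \<circ> G) p'"
    if pp: "p \<in> topspace (prod_topology ?I X)" "p' \<in> topspace (prod_topology ?I X)"
       "(fst p, \<Phi> (snd p)) = (fst p', \<Phi> (snd p'))" for p p'
  proof -
    obtain t x x' where p: "p = (t, x)" "p' = (t, x')" "0 \<le> t" "t \<le> 1"
        "x \<in> topspace X" "x' \<in> topspace X" "\<Phi> x = \<Phi> x'"
      using pp by (cases p; cases p') auto
    then show ?thesis
      using inj[OF p(5-7)] col[of "G (t, x)" "G (t, x')"] GZ by auto
  qed
  ultimately obtain J where J: "continuous_map (prod_topology ?I W) W J"
      "\<And>p. p \<in> topspace (prod_topology ?I X) \<Longrightarrow> J (fst p, \<Phi> (snd p)) = (\<Phi> \<circ> G) p"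
    using quotient_map_lift_exists[of _ _ _ W "\<Phi> \<circ> G"] by (smt (verit, best))
  have J': "J (t, \<Phi> x) = \<Phi> (G (t, x))" if "0 \<le> t" "t \<le> 1" "x \<in> topspace X" for t x
    using J(2)[of "(t, x)"] that by simp
  have "homotopic_with (\<lambda>_. True) X X id (\<Psi> \<circ> \<Phi>)"
    using G G0 \<Psi>(2) by (subst homotopic_with) (auto intro!: exI[of _ G])
  moreover have "homotopic_with (\<lambda>_. True) W W id (\<Phi> \<circ> \<Psi>)"
  proof (subst homotopic_with; (intro exI[of _ J] conjI ballI J(1))?)
    fix w assume "w \<in> topspace W"
    then obtain x where x: "x \<in> topspace X" "w = \<Phi> x"
      using \<Phi>(2) by blast
    then show "J (0, w) = id w" "J (1, w) = (\<Phi> \<circ> \<Psi>) w"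
      using J' G0 \<Psi>(2) by auto
  qed auto
  ultimately show ?thesis
    unfolding homotopy_equivalent_space_def
    using \<Phi>(1) \<Psi>(1) homotopic_with_symD by metis
qed

section \<open>Complexes that become contractible after removal of facets\<close>

lemma topspace_wedge_of_spheres:
  "topspace (wedge_of_spheres m (int d)) =
     insert (\<lambda>_. 0)
        (\<Union>k<m. {x. (\<forall>i j. x (i, j) \<noteq> 0 \<longrightarrow> i = k \<and> j \<le> d) \<and>
                    (x (k, 0) - 1)\<^sup>2 + (\<Sum>j\<in>{1..d}. (x (k, j))\<^sup>2) = 1})"
  by (auto simp: wedge_of_spheres_def)

lemma Hausdorff_space_wedge_of_spheres: "Hausdorff_space (wedge_of_spheres m d)"
  by (auto simp: wedge_of_spheres_def Hausdorff_space_product_topology intro!: Hausdorff_space_subtopology)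

text \<open>The enumeration \<open>e k\<close> of a facet singles out a reference vertex
  \<open>e k 0\<close> and orders the others; these become the coordinates of the sphere with index
  \<open>k\<close>.\<close>

locale complex_with_facets = finite_complex +
  fixes e :: "nat \<Rightarrow> nat \<Rightarrow> 'a" and m d :: nat
  assumes e_inj: "k < m \<Longrightarrow> inj_on (e k) {..d}"
    and facet: "k < m \<Longrightarrow> e k ` {..d} \<in> K"
    and facet_maximal: "k < m \<Longrightarrow> F \<in> K \<Longrightarrow> e k ` {..d} \<subseteq> F \<Longrightarrow> F = e k ` {..d}"
    and facet_inj: "inj_on (\<lambda>k. e k ` {..d}) {..<m}"
begin

definition \<sigma> :: "nat \<Rightarrow> 'a set" where "\<sigma> k = e k ` {..d}"

text \<open>On the realization this is positive exactly in the interior of the facet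
  \<open>\<sigma> k\<close>: a depth function that vanishes on the boundary.\<close>

definition \<mu> :: "nat \<Rightarrow> ('a \<Rightarrow> real) \<Rightarrow> real" where "\<mu> k f = Min (f ` \<sigma> k)"

definition Z :: "'a set set" where "Z = K - \<sigma> ` {..<m}"

lemma \<sigma>: "finite (\<sigma> k)" "\<sigma> k \<noteq> {}"
  by (auto simp: \<sigma>_def)

lemma \<sigma>_face: "k < m \<Longrightarrow> \<sigma> k \<in> K" "k < m \<Longrightarrow> \<sigma> k \<subseteq> V"
  using facet face_subset by (auto simp: \<sigma>_def)

lemma e_vertex: "k < m \<Longrightarrow> j \<le> d \<Longrightarrow> e k j \<in> V"
  using \<sigma>_face(2) by (auto simp: \<sigma>_def)

lemma sum_\<sigma>: "k < m \<Longrightarrow> sum g (\<sigma> k) = (\<Sum>j\<le>d. g (e k j))"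
  unfolding \<sigma>_def using e_inj by (simp add: sum.reindex)

lemma card_\<sigma>: "k < m \<Longrightarrow> card (\<sigma> k) = Suc d"
  unfolding \<sigma>_def using e_inj by (simp add: card_image)

text \<open>By maximality no removed facet lies inside a remaining face, so closure under subsets
  survives the removal.\<close>

lemma finite_complex_Z: "finite_complex V Z"
proof
  fix F G assume F: "F \<in> Z" "G \<subseteq> F"
  have "G \<noteq> \<sigma> k" if "k < m" for k
    using F facet_maximal[OF that, of F] that unfolding Z_def \<sigma>_def by blast
  then show "G \<in> Z"
    using F face_closed by (auto simp: Z_def)
qed (use finite_vertices face_subset in \<open>auto simp: Z_def\<close>)

text \<open>A non-zero \<open>\<mu> k f\<close> puts all of \<open>\<sigma> k\<close> into the
  support, and maximality turns this inclusion into equality. Hence the open facets are disjoint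
  from each other and from \<open>Z\<close>.\<close>

lemma facetD:
  assumes f: "f \<in> topspace (geometric_realization V K)" and k: "k < m" and "\<mu> k f \<noteq> 0"
  shows "supp V f = \<sigma> k" "0 < \<mu> k f" "f \<notin> topspace (geometric_realization V Z)"
    "sum f (\<sigma> k) = 1" "\<And>k'. k' < m \<Longrightarrow> k' \<noteq> k \<Longrightarrow> \<mu> k' f = 0"
proof -
  note P = Min_face_pos[OF f \<sigma> \<sigma>_face(2), folded \<mu>_def]
  have sK: "supp V f \<in> K"
    using f by (auto simp: topspace_geometric_realization)
  have eq: "supp V f = \<sigma> k" if "k < m" "\<mu> k f \<noteq> 0" for k
    using P(2)[OF that(1)] that facet_maximal[OF that(1) sK] by (auto simp: \<sigma>_def)
  show s: "supp V f = \<sigma> k" using eq assms by blast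
  show "0 < \<mu> k f" using P(1)[OF k] assms by linarith
  show "f \<notin> topspace (geometric_realization V Z)"
    using s k by (auto simp: topspace_geometric_realization Z_def)
  have "sum f V = sum f (supp V f)"
    using finite_vertices by (intro sum.mono_neutral_right) (auto simp: supp_def)
  then show "sum f (\<sigma> k) = 1"
    using f s by (auto simp: topspace_geometric_realization)
  show "\<mu> k' f = 0" if "k' < m" "k' \<noteq> k" for k'
    using facet_inj eq[of k'] s k that by (auto simp: inj_on_def \<sigma>_def)
qed

lemma in_Z_iff:
  assumes f: "f \<in> topspace (geometric_realization V K)"
  shows "f \<in> topspace (geometric_realization V Z) \<longleftrightarrow> (\<forall>k<m. \<mu> k f = 0)"
proof
  assume "f \<in> topspace (geometric_realization V Z)"
  then show "\<forall>k<m. \<mu> k f = 0" using facetD(3)[OF f] by blast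
next
  assume 0: "\<forall>k<m. \<mu> k f = 0"
  have "supp V f \<noteq> \<sigma> k" if "k < m" for k
    using Min_face_pos(2)[OF f \<sigma> \<sigma>_face(2)[OF that]] 0 that by (auto simp: \<mu>_def)
  then show "f \<in> topspace (geometric_realization V Z)"
    using f by (auto simp: topspace_geometric_realization Z_def)
qed

lemma topspace_Z_subset: "topspace (geometric_realization V Z) \<subseteq> topspace (geometric_realization V K)"
  by (auto simp: topspace_geometric_realization Z_def)

lemma continuous_map_\<mu>:
  "k < m \<Longrightarrow> continuous_map (geometric_realization V K) euclideanreal (\<mu> k)"
  unfolding \<mu>_def using \<sigma>_face(2)
  by (intro continuous_map_Min_image continuous_map_coordinate \<sigma>) auto

section \<open>An explicit map that collapses \<open>Z\<close> and wraps each facet around a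
  sphere\<close>

text \<open>In the coordinates \<open>z j = (f (e k j) - f (e k 0)) / \<mu> k f\<close> the open facet is \<open>\<real>\<^sup>d\<close>; an inversion
  of the hyperplane \<open>x 0 = 1\<close> at the origin takes \<open>(1, z)\<close> to the punctured sphere. The last summand of
  the denominator \<open>D\<close> vanishes on the facet and keeps \<open>D\<close> positive elsewhere.\<close>

definition D :: "nat \<Rightarrow> ('a \<Rightarrow> real) \<Rightarrow> real" where
  "D k f = (\<mu> k f)\<^sup>2 + (\<Sum>j\<in>{1..d}. (f (e k j) - f (e k 0))\<^sup>2) + (1 - sum f (\<sigma> k))\<^sup>2"

text \<open>The inversion sends \<open>(1, z)\<close> to \<open>2 (1, z) / (1 + |z|^2)\<close>,
  where the factor 2 yields radius 1 and centre at the first unit vector. Numerator and denominator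
  are multiplied by the square of \<open>\<mu> k f\<close>, so that the formula extends continuously
  by 0 to \<open>\<mu> k f = 0\<close>.\<close>

definition \<Phi> :: "('a \<Rightarrow> real) \<Rightarrow> nat \<times> nat \<Rightarrow> real" where
  "\<Phi> f = (\<lambda>(k, j). if k < m \<and> j \<le> d
     then 2 * \<mu> k f * (if j = 0 then \<mu> k f else f (e k j) - f (e k 0)) / D k f else 0)"

text \<open>If all summands vanish, \<open>f\<close> is constant on \<open>\<sigma> k\<close> with
  minimum 0, hence zero there, whereas the last summand forces the sum to be 1.\<close>

lemma D_pos:
  assumes k: "k < m"
  shows "0 < D k f"
proof (rule ccontr)
  assume "\<not> 0 < D k f"
  moreover have S: "0 \<le> (\<Sum>j\<in>{1..d}. (f (e k j) - f (e k 0))\<^sup>2)"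
    by (intro sum_nonneg) auto
  ultimately have 0: "(\<mu> k f)\<^sup>2 = 0" "(\<Sum>j\<in>{1..d}. (f (e k j) - f (e k 0))\<^sup>2) = 0"
      "(1 - sum f (\<sigma> k))\<^sup>2 = 0"
    using zero_le_power2[of "\<mu> k f"] zero_le_power2[of "1 - sum f (\<sigma> k)"]
    unfolding D_def by linarith+
  then have sq: "\<forall>j\<in>{1..d}. (f (e k j) - f (e k 0))\<^sup>2 = 0"
    by (subst (asm) sum_nonneg_eq_0_iff) auto
  have eq: "f (e k j) = f (e k 0)" if "j \<le> d" for j
  proof (cases "j = 0")
    case False
    then have "j \<in> {1..d}" using that by simp
    then have "(f (e k j) - f (e k 0))\<^sup>2 = 0" using sq by blast
    then show ?thesis by simp
  qed simp
  have "f ` \<sigma> k = (\<lambda>_. f (e k 0)) ` {..d}"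
    unfolding \<sigma>_def image_image by (rule image_cong, rule refl, rule eq) simp
  then have "f (e k 0) = 0"
    using 0(1) by (simp add: \<mu>_def image_constant_conv)
  then have "sum f (\<sigma> k) = 0"
    unfolding sum_\<sigma>[OF k] by (intro sum.neutral) (metis atMost_iff eq)
  then show False using 0(3) by simp
qed

text \<open>The coordinate \<open>(k, 0)\<close> is twice the square of \<open>\<mu> k f\<close>
  over a positive number, so it vanishes only together with \<open>\<mu> k f\<close>.\<close>

lemma \<Phi>_zero_iff:
  assumes f: "f \<in> topspace (geometric_realization V K)"
  shows "\<Phi> f = (\<lambda>_. 0) \<longleftrightarrow> f \<in> topspace (geometric_realization V Z)"
proof
  assume 0: "\<Phi> f = (\<lambda>_. 0)"
  have "\<mu> k f = 0" if "k < m" for k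
    using fun_cong[OF 0, of "(k, 0)"] that D_pos[OF that, of f] by (simp add: \<Phi>_def)
  then show "f \<in> topspace (geometric_realization V Z)"
    by (simp add: in_Z_iff[OF f])
qed (auto simp: in_Z_iff[OF f] \<Phi>_def)

lemma \<Phi>_facet:
  assumes f: "f \<in> topspace (geometric_realization V K)" and k: "k < m" "\<mu> k f \<noteq> 0"
  shows "\<Phi> f (i, j) = (if i = k \<and> j \<le> d
     then \<Phi> f (k, 0) * (if j = 0 then 1 else (f (e k j) - f (e k 0)) / \<mu> k f) else 0)"
    and "\<Phi> f (k, 0) = 2 / (1 + (\<Sum>j\<in>{1..d}. ((f (e k j) - f (e k 0)) / \<mu> k f)\<^sup>2))"
proof -
  note F = facetD[OF f k]
  show "\<Phi> f (i, j) = (if i = k \<and> j \<le> d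
     then \<Phi> f (k, 0) * (if j = 0 then 1 else (f (e k j) - f (e k 0)) / \<mu> k f) else 0)"
    using F(2,5) k by (auto simp: \<Phi>_def)
  have "D k f = (\<mu> k f)\<^sup>2 * (1 + (\<Sum>j\<in>{1..d}. ((f (e k j) - f (e k 0)) / \<mu> k f)\<^sup>2))"
    using F(2,4) by (simp add: D_def power_divide sum_distrib_left distrib_left)
  then show "\<Phi> f (k, 0) = 2 / (1 + (\<Sum>j\<in>{1..d}. ((f (e k j) - f (e k 0)) / \<mu> k f)\<^sup>2))"
    using F(2) k by (simp add: \<Phi>_def power2_eq_square)
qed

lemma \<Phi>_in_wedge:
  assumes f: "f \<in> topspace (geometric_realization V K)"
  shows "\<Phi> f \<in> topspace (wedge_of_spheres m (int d))"
proof (cases "f \<in> topspace (geometric_realization V Z)")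
  case True
  then show ?thesis
    using \<Phi>_zero_iff[OF f] by (simp add: topspace_wedge_of_spheres)
next
  case False
  then obtain k where k: "k < m" "\<mu> k f \<noteq> 0"
    using in_Z_iff[OF f] by blast
  define z where "z j = (f (e k j) - f (e k 0)) / \<mu> k f" for j
  define N where "N = (\<Sum>j\<in>{1..d}. (z j)\<^sup>2)"
  have N: "0 \<le> N" unfolding N_def by (intro sum_nonneg) auto
  have P0: "\<Phi> f (k, 0) = 2 / (1 + N)"
    unfolding N_def z_def by (rule \<Phi>_facet(2)[OF f k])
  have "(\<Phi> f (k, j))\<^sup>2 = (\<Phi> f (k, 0))\<^sup>2 * (z j)\<^sup>2" if "j \<in> {1..d}" for j
    using \<Phi>_facet(1)[OF f k, of k j] that by (simp add: z_def power_mult_distrib power_divide)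
  then have "(\<Sum>j\<in>{1..d}. (\<Phi> f (k, j))\<^sup>2) = (\<Phi> f (k, 0))\<^sup>2 * N"
    unfolding N_def sum_distrib_left by (rule sum.cong[OF refl])
  \<comment> \<open>Expanded, the sphere equation for \<open>x = \<Phi> f (k, 0)\<close> is
    \<open>x^2 (1 + N) = 2 x\<close>, which \<open>x = 2 / (1 + N)\<close> satisfies.\<close>
  then have "(\<Phi> f (k, 0) - 1)\<^sup>2 + (\<Sum>j\<in>{1..d}. (\<Phi> f (k, j))\<^sup>2)
      = (\<Phi> f (k, 0))\<^sup>2 * (1 + N) - 2 * \<Phi> f (k, 0) + 1"
    by (simp add: power2_eq_square algebra_simps)
  also have "\<dots> = 1"
    using N unfolding P0 by (simp add: power2_eq_square divide_simps)
  finally have "(\<Phi> f (k, 0) - 1)\<^sup>2 + (\<Sum>j\<in>{1..d}. (\<Phi> f (k, j))\<^sup>2) = 1" .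
  moreover have "i = k \<and> j \<le> d" if "\<Phi> f (i, j) \<noteq> 0" for i j
    using \<Phi>_facet(1)[OF f k, of i j] that by (metis (no_types))
  ultimately show ?thesis
    unfolding topspace_wedge_of_spheres using k(1) by blast
qed

lemma continuous_map_\<Phi>: "continuous_map (geometric_realization V K) (wedge_of_spheres m (int d)) \<Phi>"
proof -
  let ?X = "geometric_realization V K"
  have "continuous_map ?X euclideanreal (\<lambda>f. \<Phi> f (k, j))" for k j
  proof (cases "k < m \<and> j \<le> d")
    case True
    then have k: "k < m" "j \<le> d" by auto
    have c: "continuous_map ?X euclideanreal (\<lambda>f. f (e k i))" if "i \<le> d" for i
      using that k by (intro continuous_map_coordinate e_vertex)
    have c\<sigma>: "continuous_map ?X euclideanreal (\<lambda>f. sum f (\<sigma> k))"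
      using \<sigma>_face(2)[OF k(1)] by (intro continuous_map_sum continuous_map_coordinate \<sigma>) auto
    have "continuous_map ?X euclideanreal (\<lambda>f. \<Sum>j\<in>{1..d}. (f (e k j) - f (e k 0))\<^sup>2)"
      by (intro continuous_map_sum continuous_map_real_pow continuous_map_diff c) auto
    then have "continuous_map ?X euclideanreal (D k)"
      unfolding D_def
      by (intro continuous_map_add continuous_map_real_pow continuous_map_diff continuous_map_\<mu>[OF k(1)] c\<sigma>) auto
    moreover have "continuous_map ?X euclideanreal (\<lambda>f. if j = 0 then \<mu> k f else f (e k j) - f (e k 0))"
      using k by (cases "j = 0") (auto intro: continuous_map_\<mu> c continuous_map_diff)
    moreover have "D k f \<noteq> 0" for f
      using D_pos[OF k(1), of f] by simp
    ultimately have "continuous_map ?X euclideanreal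
        (\<lambda>f. 2 * \<mu> k f * (if j = 0 then \<mu> k f else f (e k j) - f (e k 0)) / D k f)"
      by (intro continuous_map_real_divide continuous_map_real_mult continuous_map_\<mu>[OF k(1)]) auto
    then show ?thesis
      using k by (simp add: \<Phi>_def)
  next
    case False
    then have "(\<lambda>f. \<Phi> f (k, j)) = (\<lambda>_. 0)"
      by (auto simp: \<Phi>_def)
    then show ?thesis by simp
  qed
  then have "continuous_map ?X (powertop_real UNIV) \<Phi>"
    by (intro continuous_map_coordinatewise_then_product) auto
  then show ?thesis
    using \<Phi>_in_wedge unfolding wedge_of_spheres_def
    by (auto simp: topspace_wedge_of_spheres intro!: continuous_map_into_subtopology)
qed

text \<open>The origin is the image of any point of \<open>Z\<close>; every other point of a sphere
  is traced back through the inversion to an open facet.\<close>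

lemma \<Phi>_surj:
  assumes ne: "topspace (geometric_realization V Z) \<noteq> {}"
  shows "\<Phi> ` topspace (geometric_realization V K) = topspace (wedge_of_spheres m (int d))"
proof (intro equalityI subsetI)
  fix x assume x: "x \<in> topspace (wedge_of_spheres m (int d))"
  show "x \<in> \<Phi> ` topspace (geometric_realization V K)"
  proof (cases "x = (\<lambda>_. 0)")
    case True
    obtain f where f: "f \<in> topspace (geometric_realization V Z)"
      using ne by blast
    then have fK: "f \<in> topspace (geometric_realization V K)"
      using topspace_Z_subset by blast
    have "x = \<Phi> f"
      using \<Phi>_zero_iff[OF fK] f True by simp
    then show ?thesis
      using fK by (rule image_eqI)
  next
    case False
    then have "x \<in> (\<Union>k<m. {x. (\<forall>i j. x (i, j) \<noteq> 0 \<longrightarrow> i = k \<and> j \<le> d) \<and>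
        (x (k, 0) - 1)\<^sup>2 + (\<Sum>j\<in>{1..d}. (x (k, j))\<^sup>2) = 1})"
      using x unfolding topspace_wedge_of_spheres by blast
    then obtain k where k: "k < m" and x0: "\<And>i j. x (i, j) \<noteq> 0 \<Longrightarrow> i = k \<and> j \<le> d"
      and sph: "(x (k, 0) - 1)\<^sup>2 + (\<Sum>j\<in>{1..d}. (x (k, j))\<^sup>2) = 1"
      by blast
    have q: "(x (k, 0))\<^sup>2 + (\<Sum>j\<in>{1..d}. (x (k, j))\<^sup>2) = 2 * x (k, 0)"
      using sph by (simp add: power2_eq_square algebra_simps)
    \<comment> \<open>The squared norm on the sphere equals \<open>2 * x (k, 0)\<close>, so a
      vanishing first coordinate leaves only the origin.\<close>
    have nz: "x (k, 0) \<noteq> 0"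
    proof
      assume 0: "x (k, 0) = 0"
      with q have "(\<Sum>j\<in>{1..d}. (x (k, j))\<^sup>2) = 0"
        by simp
      then have 1: "x (k, j) = 0" if "j \<in> {1..d}" for j
        using that by (subst (asm) sum_nonneg_eq_0_iff) auto
      have "x (i, j) = 0" for i j
      proof (rule ccontr)
        assume nz: "x (i, j) \<noteq> 0"
        from x0[OF nz] nz 0 1[of j] show False
          by (cases "j = 0") auto
      qed
      then have "x p = 0" for p
        by (cases p) simp
      then show False using False by blast
    qed
    define z where "z j = (if j = 0 then 0 else x (k, j) / x (k, 0))" for j
    define N where "N = (\<Sum>j\<in>{1..d}. (z j)\<^sup>2)"
    have N: "0 \<le> N" unfolding N_def by (intro sum_nonneg) auto
    have "(\<Sum>j\<in>{1..d}. (x (k, j))\<^sup>2) = (x (k, 0))\<^sup>2 * N"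
      unfolding N_def sum_distrib_left using nz
      by (intro sum.cong) (auto simp: z_def power_divide)
    then have "x (k, 0) * (x (k, 0) * (1 + N)) = x (k, 0) * 2"
      using q by (simp add: power2_eq_square algebra_simps)
    then have "x (k, 0) * (1 + N) = 2"
      using nz by (simp only: mult_left_cancel simp_thms)
    then have xk0: "x (k, 0) = 2 / (1 + N)"
      using N by (simp add: field_simps)
    \<comment> \<open>The differences \<open>z\<close> fix the barycentric coordinates up to a shift
      and a scale. The shift is chosen to make the minimum 1 and the scale to make the sum 1, so
      that the depth becomes \<open>1 / S\<close>.\<close>
    define w where "w j = 1 + z j - Min (z ` {..d})" for j
    define S where "S = (\<Sum>j\<le>d. w j)"
    have w1: "1 \<le> w j" if "j \<le> d" for j
    proof -
      have "Min (z ` {..d}) \<le> z j"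
        using that by (intro Min_le) auto
      then show ?thesis
        unfolding w_def by linarith
    qed
    have "Min (z ` {..d}) \<in> z ` {..d}"
      by (intro Min_in) auto
    then obtain j0 where "j0 \<in> {..d}" and j0z: "Min (z ` {..d}) = z j0"
      by (rule imageE)
    then have j0: "j0 \<le> d" "w j0 = 1"
      by (auto simp: w_def j0z)
    have "S \<ge> w 0"
      unfolding S_def
    proof (rule member_le_sum)
      show "0 \<le> w j" if "j \<in> {..d} - {0}" for j
        using w1[of j] that by simp
    qed auto
    then have S: "S > 0" using w1[of 0] by simp
    define f where "f = (\<lambda>v\<in>V. if v \<in> \<sigma> k then w (inv_into {..d} (e k) v) / S else 0)"
    have fe: "f (e k j) = w j / S" if "j \<le> d" for j
      using that e_inj[OF k] e_vertex[OF k that] by (auto simp: f_def \<sigma>_def)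
    have f0: "f v = 0" if "v \<in> V" "v \<notin> \<sigma> k" for v
      using that by (simp add: f_def)
    have fpos: "f v > 0" if "v \<in> \<sigma> k" for v
      using that fe w1 S by (force simp: \<sigma>_def intro!: divide_pos_pos)
    have "sum f V = sum f (\<sigma> k)"
      using finite_vertices \<sigma>_face(2)[OF k] f0 by (intro sum.mono_neutral_right) auto
    also have "\<dots> = 1"
      using S by (simp add: sum_\<sigma>[OF k] fe sum_divide_distrib[symmetric] S_def[symmetric])
    finally have "sum f V = 1" .
    moreover have "supp V f = \<sigma> k"
      using \<sigma>_face(2)[OF k] fpos f0 by (force simp: supp_def)
    moreover have "0 \<le> f v" if "v \<in> V" for v
      using f0[OF that] fpos[of v] by (cases "v \<in> \<sigma> k") auto
    ultimately have f: "f \<in> topspace (geometric_realization V K)"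
      using \<sigma>_face(1)[OF k] by (auto simp: topspace_geometric_realization f_def)
    have "\<mu> k f = 1 / S"
      unfolding \<mu>_def
    proof (rule Min_eqI)
      show "1 / S \<in> f ` \<sigma> k"
        using j0 fe[OF j0(1)] by (auto simp: \<sigma>_def image_iff intro!: bexI[of _ j0])
      show "1 / S \<le> y" if "y \<in> f ` \<sigma> k" for y
        using that fe w1 S by (auto simp: \<sigma>_def divide_right_mono)
    qed (use \<sigma> in auto)
    then have \<mu>k: "\<mu> k f = 1 / S" "\<mu> k f \<noteq> 0" using S by auto
    have z0: "z 0 = 0" by (simp add: z_def)
    have zz: "(f (e k j) - f (e k 0)) / \<mu> k f = z j" if "j \<le> d" for j
    proof -
      have "(f (e k j) - f (e k 0)) / \<mu> k f = w j - w 0"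
        using S by (simp add: fe[OF that] fe[OF le0] \<mu>k(1) diff_divide_distrib[symmetric])
      also have "\<dots> = z j"
        unfolding w_def using z0 by linarith
      finally show ?thesis .
    qed
    have "(\<Sum>j\<in>{1..d}. ((f (e k j) - f (e k 0)) / \<mu> k f)\<^sup>2) = N"
      unfolding N_def
    proof (rule sum.cong)
      fix j assume "j \<in> {1..d}"
      then have "j \<le> d" by simp
      then show "((f (e k j) - f (e k 0)) / \<mu> k f)\<^sup>2 = (z j)\<^sup>2"
        by (simp only: zz)
    qed simp
    then have \<Phi>0: "\<Phi> f (k, 0) = x (k, 0)"
      using \<Phi>_facet(2)[OF f k \<mu>k(2)] xk0 by simp
    have "\<Phi> f (i, j) = x (i, j)" for i j
    proof (cases "i = k \<and> j \<le> d")
      case True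
      then have "\<Phi> f (i, j) = x (k, 0) * (if j = 0 then 1 else z j)"
        using \<Phi>_facet(1)[OF f k \<mu>k(2), of i j] zz[of j] \<Phi>0 by simp
      also have "\<dots> = x (i, j)"
        using nz True by (simp add: z_def)
      finally show ?thesis .
    next
      case False
      then have "x (i, j) = 0"
        using x0[of i j] by blast
      with False show ?thesis
        using \<Phi>_facet(1)[OF f k \<mu>k(2), of i j] by (simp only: if_False)
    qed
    then have "\<Phi> f p = x p" for p
      by (cases p) simp
    then have "x = \<Phi> f"
      by (intro ext) (rule sym)
    then show ?thesis
      using f by (rule image_eqI)
  qed
next
  fix x assume "x \<in> \<Phi> ` topspace (geometric_realization V K)"
  then obtain f where "x = \<Phi> f" "f \<in> topspace (geometric_realization V K)"
    by (rule imageE)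
  then show "x \<in> topspace (wedge_of_spheres m (int d))"
    by (simp only: \<Phi>_in_wedge)
qed

text \<open>Ratios of coordinates of \<open>\<Phi> f\<close> return the differences of the numbers
  \<open>f (e k j) / \<mu> k f\<close>. Their minimum is 1, which fixes the numbers themselves, and
  the total mass 1 then fixes \<open>\<mu> k f\<close>.\<close>

lemma \<Phi>_inj:
  assumes f: "f \<in> topspace (geometric_realization V K)" and g: "g \<in> topspace (geometric_realization V K)"
    and eq: "\<Phi> f = \<Phi> g" and fZ: "f \<notin> topspace (geometric_realization V Z)"
  shows "f = g"
proof -
  obtain k where k: "k < m" "\<mu> k f \<noteq> 0"
    using fZ in_Z_iff[OF f] by blast
  have nz: "\<Phi> f (k, 0) \<noteq> 0"
    using k D_pos[OF k(1), of f] by (simp add: \<Phi>_def)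
  then have kg: "\<mu> k g \<noteq> 0"
    using k(1) unfolding eq by (intro notI) (simp add: \<Phi>_def)
  note Ff = facetD[OF f k] and Fg = facetD[OF g k(1) kg]
  define a b where "a j = f (e k j) / \<mu> k f" and "b j = g (e k j) / \<mu> k g" for j
  have ab: "a j - a 0 = b j - b 0" if "j \<le> d" for j
  proof (cases "j = 0")
    case False
    then have "\<Phi> f (k, 0) * (a j - a 0) = \<Phi> g (k, 0) * (b j - b 0)"
      using \<Phi>_facet(1)[OF f k, of k j] \<Phi>_facet(1)[OF g k(1) kg, of k j] that fun_cong[OF eq, of "(k, j)"]
      by (simp add: a_def b_def diff_divide_distrib)
    then show ?thesis using nz eq by simp
  qed simp
  have 1: "(\<exists>j\<le>d. h (e k j) / \<mu> k h = 1) \<and> (\<forall>j\<le>d. 1 \<le> h (e k j) / \<mu> k h)" if "0 < \<mu> k h" for h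
  proof -
    have "\<mu> k h \<in> h ` \<sigma> k" "\<forall>y\<in>h ` \<sigma> k. \<mu> k h \<le> y"
      using \<sigma> by (auto simp: \<mu>_def)
    then show ?thesis using that by (force simp: \<sigma>_def)
  qed
  obtain i j where ij: "i \<le> d" "a i = 1" "j \<le> d" "b j = 1"
    using 1[OF Ff(2)] 1[OF Fg(2)] by (auto simp: a_def b_def)
  \<comment> \<open>Both families have minimum 1 and equal differences; evaluating each at the
    minimizer of the other gives the two inequalities between \<open>a 0\<close> and
    \<open>b 0\<close>.\<close>
  have "1 \<le> a j" "1 \<le> b i"
    using 1[OF Ff(2)] 1[OF Fg(2)] ij by (auto simp: a_def b_def)
  then have "a 0 = b 0"
    using ab[of i] ab[of j] ij by linarith
  then have ab': "a j = b j" if "j \<le> d" for j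
    using ab[OF that] by simp
  have fa: "f (e k j) = \<mu> k f * a j" "g (e k j) = \<mu> k g * b j" for j
    using Ff(2) Fg(2) by (auto simp: a_def b_def)
  have "\<mu> k f * (\<Sum>j\<le>d. a j) = 1" "\<mu> k g * (\<Sum>j\<le>d. b j) = 1"
    using Ff(4) Fg(4) by (auto simp: sum_\<sigma>[OF k(1)] fa sum_distrib_left)
  moreover have "(\<Sum>j\<le>d. a j) = (\<Sum>j\<le>d. b j)"
    using ab' by (intro sum.cong) auto
  ultimately have "\<mu> k f = \<mu> k g"
    by (metis mult_cancel_right mult_zero_right zero_neq_one)
  then have "f v = g v" if "v \<in> \<sigma> k" for v
    using that ab' fa by (auto simp: \<sigma>_def)
  moreover have "f v = g v" if "v \<in> V" "v \<notin> \<sigma> k" for v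
  proof -
    have "v \<notin> supp V f" "v \<notin> supp V g"
      using that Ff(1) Fg(1) by auto
    then show ?thesis
      using that by (simp add: supp_def)
  qed
  moreover have "f v = g v" if "v \<notin> V" for v
    using that f g by (auto simp: topspace_geometric_realization extensional_def)
  ultimately show ?thesis by blast
qed

section \<open>Facets as cones over their boundary, and extension of a contraction\<close>

definition apex_part :: "('a \<Rightarrow> real) \<Rightarrow> real" where
  "apex_part f = (\<Sum>k<m. Suc d * \<mu> k f)"

text \<open>What remains after the barycentre with its weight \<open>apex_part f\<close> is taken
  out; it is not rescaled to mass 1. On the realization at most one facet contributes, and the sum
  over all of them yields a single continuous formula.\<close>

definition base_part :: "('a \<Rightarrow> real) \<Rightarrow> 'a \<Rightarrow> real" where
  "base_part f v = f v - (\<Sum>k<m. \<mu> k f * of_bool (v \<in> \<sigma> k))"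

lemma sum_facet_only:
  fixes g :: "nat \<Rightarrow> real"
  assumes "k < m" "\<And>k'. k' < m \<Longrightarrow> k' \<noteq> k \<Longrightarrow> g k' = 0"
  shows "(\<Sum>k'<m. g k') = g k"
proof -
  have "(\<Sum>k'<m. g k') = g k + (\<Sum>k'\<in>{..<m} - {k}. g k')"
    using assms(1) by (intro sum.remove) auto
  also have "(\<Sum>k'\<in>{..<m} - {k}. g k') = 0"
    using assms(2) by (intro sum.neutral) auto
  finally show ?thesis by simp
qed

lemma apex_part_bounds:
  assumes f: "f \<in> topspace (geometric_realization V K)" and k: "k < m"
  shows "0 \<le> \<mu> k f" "Suc d * \<mu> k f \<le> apex_part f" "0 \<le> apex_part f"
proof -
  have nn: "0 \<le> \<mu> k f" if "k < m" for k
    using Min_face_pos(1)[OF f \<sigma> \<sigma>_face(2)[OF that]] by (simp add: \<mu>_def)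
  then show "0 \<le> \<mu> k f" using k by blast
  show le: "Suc d * \<mu> k f \<le> apex_part f"
    unfolding apex_part_def
    by (rule member_le_sum[where f = "\<lambda>k. Suc d * \<mu> k f"]) (use k nn in auto)
  show "0 \<le> apex_part f"
    using le nn[OF k] by (meson mult_nonneg_nonneg of_nat_0_le_iff order_trans)
qed

lemma parts_base:
  assumes f: "f \<in> topspace (geometric_realization V Z)"
  shows "apex_part f = 0" "base_part f v = f v"
proof -
  have "f \<in> topspace (geometric_realization V K)"
    using f topspace_Z_subset by blast
  then have "\<mu> k f = 0" if "k < m" for k
    using f that in_Z_iff by blast
  then show "apex_part f = 0" "base_part f v = f v"
    by (simp_all add: apex_part_def base_part_def)
qed

lemma parts_facet:
  assumes f: "f \<in> topspace (geometric_realization V K)" and k: "k < m" "\<mu> k f \<noteq> 0"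
  shows "apex_part f = Suc d * \<mu> k f" "base_part f v = f v - \<mu> k f * of_bool (v \<in> \<sigma> k)"
    "\<And>v. v \<in> \<sigma> k \<Longrightarrow> \<mu> k f \<le> f v" "supp V (base_part f) \<in> Z" "supp V (base_part f) \<subseteq> supp V f"
    "sum (base_part f) V = 1 - apex_part f"
proof -
  note F = facetD[OF f k]
  show a: "apex_part f = Suc d * \<mu> k f"
    unfolding apex_part_def using F(5) by (intro sum_facet_only k(1)) simp
  have "(\<Sum>k'<m. \<mu> k' f * of_bool (v \<in> \<sigma> k')) = \<mu> k f * of_bool (v \<in> \<sigma> k)" for v
    using F(5) by (intro sum_facet_only k(1)) simp
  then show b: "base_part f v = f v - \<mu> k f * of_bool (v \<in> \<sigma> k)" for v
    by (simp only: base_part_def)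
  show le: "\<And>v. v \<in> \<sigma> k \<Longrightarrow> \<mu> k f \<le> f v"
    using \<sigma>(1) by (simp add: \<mu>_def)
  have s: "supp V (base_part f) \<subseteq> \<sigma> k"
  proof
    fix v assume v: "v \<in> supp V (base_part f)"
    show "v \<in> \<sigma> k"
    proof (rule ccontr)
      assume n: "v \<notin> \<sigma> k"
      then have "v \<notin> supp V f" using F(1) by simp
      then show False
        using v n by (simp add: supp_def b)
    qed
  qed
  then show "supp V (base_part f) \<subseteq> supp V f" using F(1) by simp
  have "\<mu> k f \<in> f ` \<sigma> k"
    using \<sigma> by (simp add: \<mu>_def)
  \<comment> \<open>The vertex \<open>w\<close> of smallest coordinate drops out, so the base part
    is supported on a proper face of the facet, which belongs to \<open>Z\<close>.\<close>
  then obtain w where w: "w \<in> \<sigma> k" "\<mu> k f = f w" by blast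
  then have "w \<notin> supp V (base_part f)"
    by (simp add: supp_def b)
  then have ne: "supp V (base_part f) \<noteq> \<sigma> k" using w(1) by blast
  have "supp V (base_part f) \<in> K"
    using s \<sigma>_face(1)[OF k(1)] face_closed by blast
  moreover have "supp V (base_part f) \<noteq> \<sigma> k'" if "k' < m" for k'
  proof
    assume eq: "supp V (base_part f) = \<sigma> k'"
    then have "\<sigma> k = \<sigma> k'"
      using facet_maximal[OF that \<sigma>_face(1)[OF k(1)]] s by (simp add: \<sigma>_def)
    with eq ne show False by simp
  qed
  ultimately show "supp V (base_part f) \<in> Z"
    by (auto simp: Z_def)
  have "(\<Sum>v\<in>V. of_bool (v \<in> \<sigma> k)) = real (card (\<sigma> k))"
    using finite_vertices \<sigma>_face(2)[OF k(1)] by (simp add: of_bool_def sum.If_cases Int_absorb1)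
  then show "sum (base_part f) V = 1 - apex_part f"
    using f by (simp add: b a sum_subtractf sum_distrib_left[symmetric] card_\<sigma>[OF k(1)]
        topspace_geometric_realization)
qed

lemma base_cases:
  assumes "f \<in> topspace (geometric_realization V K)"
  obtains "f \<in> topspace (geometric_realization V Z)"
    | k where "k < m" "\<mu> k f \<noteq> 0"
  using assms in_Z_iff by blast

lemma base_part_props:
  assumes f: "f \<in> topspace (geometric_realization V K)"
  shows "\<And>v. v \<in> V \<Longrightarrow> 0 \<le> base_part f v" "supp V (base_part f) \<in> Z"
    "supp V (base_part f) \<subseteq> supp V f" "sum (base_part f) V = 1 - apex_part f"
proof -
  have "(\<forall>v\<in>V. 0 \<le> base_part f v) \<and> supp V (base_part f) \<in> Z \<and>
    supp V (base_part f) \<subseteq> supp V f \<and> sum (base_part f) V = 1 - apex_part f"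
    using f
  proof (cases rule: base_cases)
    case 1
    have "base_part f = f" using parts_base(2)[OF 1] by blast
    then show ?thesis
      using 1 parts_base(1)[OF 1] by (simp add: topspace_geometric_realization)
  next
    case (2 k)
    note P = parts_facet[OF f 2]
    have "0 \<le> base_part f v" if "v \<in> V" for v
      using P(2)[of v] P(3)[of v] that f by (cases "v \<in> \<sigma> k") (auto simp: topspace_geometric_realization)
    then show ?thesis using P(4-6) by blast
  qed
  then show "\<And>v. v \<in> V \<Longrightarrow> 0 \<le> base_part f v" "supp V (base_part f) \<in> Z"
    "supp V (base_part f) \<subseteq> supp V f" "sum (base_part f) V = 1 - apex_part f"
    by blast+
qed

lemma continuous_map_apex_part:
  "continuous_map (geometric_realization V K) euclideanreal apex_part"
  unfolding apex_part_def
  by (intro continuous_map_sum continuous_map_real_mult continuous_map_\<mu>) auto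

lemma continuous_map_base_part:
  assumes "v \<in> V"
  shows "continuous_map (geometric_realization V K) euclideanreal (\<lambda>f. base_part f v)"
  unfolding base_part_def
  by (intro continuous_map_diff continuous_map_coordinate assms continuous_map_sum
      continuous_map_real_mult continuous_map_\<mu>) auto

text \<open>A point of a facet is a convex combination of the barycentre, with weight \<open>apex_part f\<close>, and a
  boundary point, a multiple of \<open>base_part f\<close>. At time \<open>s\<close> the part of the facet with
  \<open>2 * apex_part f \<ge> s\<close> is stretched over the whole facet, and the remaining collar follows the
  contraction \<open>H\<close> of the boundary point for the time \<open>s - 2 * apex_part f\<close>.\<close>

lemma contraction_extends:
  assumes H: "continuous_map (prod_topology (top_of_set {0..1::real}) (geometric_realization V Z))
      (geometric_realization V Z) H"
    and H0: "\<And>f. f \<in> topspace (geometric_realization V Z) \<Longrightarrow> H (0, f) = f"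
  obtains G where
    "continuous_map (prod_topology (top_of_set {0..1::real}) (geometric_realization V K))
      (geometric_realization V K) G"
    "\<And>f. f \<in> topspace (geometric_realization V K) \<Longrightarrow> G (0, f) = f"
    "\<And>s f. \<lbrakk>0 \<le> s; f \<in> topspace (geometric_realization V Z)\<rbrakk> \<Longrightarrow> G (s, f) = H (s, f)"
proof -
  let ?I = "top_of_set {0..1::real}"
  let ?X = "geometric_realization V K" and ?Z = "geometric_realization V Z"
  let ?P = "prod_topology ?I ?X"
  \<comment> \<open>Radial projection from the barycentre to the boundary; it is meaningful while
    \<open>apex_part\<close> is below 1.\<close>
  define B where "B p = (\<lambda>v\<in>V. base_part (snd p) v / (1 - apex_part (snd p)))"
    for p :: "real \<times> ('a \<Rightarrow> real)"
  \<comment> \<open>With \<open>a\<close> the cone weight and \<open>s\<close> the time, the new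
    weight is \<open>(2 a - s) / (2 - s)\<close>, the affine function that is 0 at
    \<open>a = s / 2\<close> and 1 at \<open>a = 1\<close>. The complementary weight is
    \<open>2 / (2 - s)\<close> times \<open>1 - a\<close>, whence the factor on the base part. The
    \<open>max\<close> removes the facets other than the one that holds the point.\<close>
  define E where "E p = (\<lambda>v\<in>V. 2 / (2 - fst p) * base_part (snd p) v +
      (\<Sum>k<m. max 0 (2 * \<mu> k (snd p) - fst p / Suc d) / (2 - fst p) * of_bool (v \<in> \<sigma> k)))"
    for p :: "real \<times> ('a \<Rightarrow> real)"
  define G where "G p = (if 2 * apex_part (snd p) \<le> fst p
      then H (fst p - 2 * apex_part (snd p), B p) else E p)" for p
  have pD: "0 \<le> fst p" "fst p \<le> 1" "snd p \<in> topspace ?X" if "p \<in> topspace ?P" for p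
    using that by auto
  have nn: "0 \<le> apex_part (snd p)" if "p \<in> topspace ?P" for p
  proof (cases rule: base_cases[OF pD(3)[OF that]])
    case 1
    then show ?thesis by (simp add: parts_base)
  next
    case (2 k)
    then show ?thesis using apex_part_bounds(3)[OF pD(3)[OF that]] by blast
  qed
  have cfst: "continuous_map ?P euclideanreal fst"
    by (metis continuous_map_fst continuous_map_into_fulltopology)
  have csnd: "continuous_map ?P euclideanreal (\<lambda>p. h (snd p))"
    if "continuous_map ?X euclideanreal h" for h
    using continuous_map_compose[OF continuous_map_snd that] by (simp add: o_def)
  have capex: "continuous_map ?P euclideanreal (\<lambda>p. apex_part (snd p))"
    by (rule csnd[OF continuous_map_apex_part])
  have cbase: "continuous_map ?P euclideanreal (\<lambda>p. base_part (snd p) v)" if "v \<in> V" for v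
    by (rule csnd[OF continuous_map_base_part[OF that]])
  have ZX: "topspace ?Z \<subseteq> topspace ?X" by (rule topspace_Z_subset)
  have BZ: "B p \<in> topspace ?Z" if p: "p \<in> topspace ?P" and t: "apex_part (snd p) < 1" for p
  proof -
    note b = base_part_props[OF pD(3)[OF p]]
    have "sum (B p) V = sum (base_part (snd p)) V / (1 - apex_part (snd p))"
      by (simp add: B_def sum_divide_distrib)
    then have "sum (B p) V = 1"
      using b(4) t by simp
    moreover have "supp V (B p) = supp V (base_part (snd p))"
      using t by (auto simp: supp_def B_def)
    ultimately show ?thesis
      using b t unfolding topspace_geometric_realization by (simp add: B_def)
  qed
  have EX: "E p \<in> topspace ?X" if p: "p \<in> topspace ?P" and t: "fst p \<le> 2 * apex_part (snd p)" for p
  proof -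
    note b = base_part_props[OF pD(3)[OF p]]
    have s: "0 \<le> fst p" "0 < 2 - fst p" using pD[OF p] by auto
    have nonneg: "0 \<le> E p v" if "v \<in> V" for v
      using b(1)[OF that] s that unfolding E_def
      by (simp add: sum_nonneg)
    have "sum (E p) V = 1 \<and> supp V (E p) \<subseteq> supp V (snd p)"
    proof (cases rule: base_cases[OF pD(3)[OF p]])
      case 1
      \<comment> \<open>Points of \<open>Z\<close> have weight 0, so they fall under
        \<open>E\<close> at time 0 only, where \<open>E\<close> is the identity.\<close>
      then have "fst p = 0" using parts_base(1)[OF 1] t s by simp
      moreover have "\<mu> k (snd p) = 0" if "k < m" for k
        using in_Z_iff[OF pD(3)[OF p]] 1 that by blast
      ultimately have eq: "E p v = snd p v" if "v \<in> V" for v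
        using that parts_base(2)[OF 1] by (simp add: E_def)
      then have "sum (E p) V = sum (snd p) V" by (intro sum.cong) auto
      moreover have "supp V (E p) = supp V (snd p)" using eq by (auto simp: supp_def)
      ultimately show ?thesis
        using 1 by (simp add: topspace_geometric_realization)
    next
      case (2 k)
      note F = facetD[OF pD(3)[OF p] 2] and Q = parts_facet[OF pD(3)[OF p] 2]
      define \<rho> where "\<rho> = (2 * \<mu> k (snd p) - fst p / Suc d) / (2 - fst p)"
      have "0 \<le> 2 * \<mu> k (snd p) - fst p / Suc d"
        using t unfolding Q(1) by (simp add: field_simps)
      moreover have "max 0 (2 * \<mu> k' (snd p) - fst p / Suc d) = 0" if "k' < m" "k' \<noteq> k" for k'
        using F(5)[OF that] s by simp
      ultimately have "(\<Sum>k<m. max 0 (2 * \<mu> k (snd p) - fst p / Suc d) / (2 - fst p) * of_bool (v \<in> \<sigma> k))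
          = \<rho> * of_bool (v \<in> \<sigma> k)" for v
        by (subst sum_facet_only[OF 2(1)]) (simp_all add: \<rho>_def)
      then have eq: "E p v = 2 / (2 - fst p) * base_part (snd p) v + \<rho> * of_bool (v \<in> \<sigma> k)" if "v \<in> V" for v
        using that by (simp add: E_def)
      have "(\<Sum>v\<in>V. of_bool (v \<in> \<sigma> k)) = real (Suc d)"
        using finite_vertices \<sigma>_face(2)[OF 2(1)] card_\<sigma>[OF 2(1)]
        by (simp add: of_bool_def sum.If_cases Int_absorb1 del: of_nat_Suc)
      moreover have "sum (E p) V = 2 / (2 - fst p) * sum (base_part (snd p)) V +
          \<rho> * (\<Sum>v\<in>V. of_bool (v \<in> \<sigma> k))"
        unfolding sum_distrib_left sum.distrib[symmetric] by (rule sum.cong[OF refl eq])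
      ultimately have "sum (E p) V = 2 / (2 - fst p) * (1 - apex_part (snd p)) + \<rho> * Suc d"
        by (simp only: b(4))
      also have "\<rho> * Suc d = (2 * apex_part (snd p) - fst p) / (2 - fst p)"
      proof -
        have "(2 * \<mu> k (snd p) - fst p / Suc d) * Suc d = 2 * apex_part (snd p) - fst p"
          unfolding Q(1) by (simp add: left_diff_distrib del: of_nat_Suc)
        then show ?thesis
          unfolding \<rho>_def times_divide_eq_left by (simp only:)
      qed
      also have "2 / (2 - fst p) * (1 - apex_part (snd p)) + \<dots> = 1"
        using s by (simp add: divide_simps)
      finally have "sum (E p) V = 1" .
      moreover have "supp V (E p) \<subseteq> supp V (snd p)"
      proof
        fix v assume v: "v \<in> supp V (E p)"
        show "v \<in> supp V (snd p)"
        proof (rule ccontr)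
          assume n: "v \<notin> supp V (snd p)"
          then have "v \<notin> supp V (base_part (snd p))" "v \<notin> \<sigma> k"
            using b(3) F(1) by auto
          then show False
            using v eq[of v] by (simp add: supp_def)
        qed
      qed
      ultimately show ?thesis by blast
    qed
    moreover have "supp V (snd p) \<in> K"
      using pD(3)[OF p] by (simp add: topspace_geometric_realization)
    moreover have "E p \<in> extensional V" by (simp add: E_def)
    ultimately show ?thesis
      using nonneg face_closed unfolding topspace_geometric_realization by blast
  qed
  have "continuous_map ?P ?X G"
    unfolding G_def
  proof (rule continuous_map_cases_le)
    show "continuous_map ?P euclideanreal (\<lambda>p. 2 * apex_part (snd p))"
      by (intro continuous_map_real_mult capex) auto
    show "continuous_map ?P euclideanreal fst" by (rule cfst)
    show "continuous_map (subtopology ?P {p \<in> topspace ?P. 2 * apex_part (snd p) \<le> fst p}) ?X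
        (\<lambda>p. H (fst p - 2 * apex_part (snd p), B p))" (is "continuous_map ?S _ _")
    proof -
      have S: "p \<in> topspace ?P" "2 * apex_part (snd p) \<le> fst p" "apex_part (snd p) < 1"
        if "p \<in> topspace ?S" for p
      proof -
        have p: "p \<in> topspace ?P" "2 * apex_part (snd p) \<le> fst p"
          using that by (auto simp only: topspace_subtopology)
        then show "p \<in> topspace ?P" "2 * apex_part (snd p) \<le> fst p" by auto
        \<comment> \<open>In the collar the weight is at most half the time, hence at most 1/2; this
          keeps the projection \<open>B\<close> away from the barycentre.\<close>
        show "apex_part (snd p) < 1" using p(2) pD(2)[OF p(1)] by linarith
      qed
      have "continuous_map ?S ?Z B"
      proof (rule continuous_map_into_geometric_realization)
        fix v assume v: "v \<in> V"
        have "continuous_map ?S euclideanreal (\<lambda>p. base_part (snd p) v / (1 - apex_part (snd p)))"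
          using S(3)
          by (intro continuous_map_real_divide continuous_map_diff continuous_map_from_subtopology[OF capex]
            continuous_map_from_subtopology[OF cbase[OF v]]) force+
        then show "continuous_map ?S euclideanreal (\<lambda>p. B p v)"
          using v by (simp add: B_def)
      qed (use S BZ in blast)
      moreover have "continuous_map ?S ?I (\<lambda>p. fst p - 2 * apex_part (snd p))"
      proof (rule continuous_map_into_subtopology)
        show "continuous_map ?S euclideanreal (\<lambda>p. fst p - 2 * apex_part (snd p))"
          by (intro continuous_map_from_subtopology continuous_map_diff continuous_map_real_mult capex cfst) auto
        have "fst p - 2 * apex_part (snd p) \<in> {0..1}" if "p \<in> topspace ?S" for p
          using S[OF that] pD[OF S(1)[OF that]] nn[OF S(1)[OF that]] by auto
        then show "(\<lambda>p. fst p - 2 * apex_part (snd p)) \<in> topspace ?S \<rightarrow> {0..1}" by blast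
      qed
      ultimately have "continuous_map ?S (prod_topology ?I ?Z) (\<lambda>p. (fst p - 2 * apex_part (snd p), B p))"
        by (simp only: continuous_map_paired)
      then have HB: "continuous_map ?S ?Z (\<lambda>p. H (fst p - 2 * apex_part (snd p), B p))"
        using continuous_map_compose[OF _ H] by (auto simp only: o_def)
      show ?thesis
      proof (rule continuous_map_into_geometric_realization)
        fix v assume "v \<in> V"
        then show "continuous_map ?S euclideanreal (\<lambda>p. H (fst p - 2 * apex_part (snd p), B p) v)"
          using continuous_map_compose[OF HB continuous_map_coordinate] by (simp only: o_def)
      qed (use HB ZX in \<open>auto simp only: continuous_map_def Pi_iff\<close>)
    qed
    show "continuous_map (subtopology ?P {p \<in> topspace ?P. fst p \<le> 2 * apex_part (snd p)}) ?X E"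
      (is "continuous_map ?S _ _")
    proof (rule continuous_map_into_geometric_realization)
      have S: "p \<in> topspace ?P" "fst p \<le> 2 * apex_part (snd p)" if "p \<in> topspace ?S" for p
        using that by (auto simp only: topspace_subtopology)
      show "E p \<in> topspace ?X" if "p \<in> topspace ?S" for p
        using EX S[OF that] by blast
      fix v assume v: "v \<in> V"
      have c\<mu>: "continuous_map ?P euclideanreal (\<lambda>p. \<mu> k (snd p))" if "k < m" for k
        by (rule csnd[OF continuous_map_\<mu>[OF that]])
      have c2: "continuous_map ?P euclideanreal (\<lambda>p. 2 - fst p)"
        by (intro continuous_map_diff cfst) auto
      have ne: "2 - fst p \<noteq> 0" if "p \<in> topspace ?P" for p
        using pD(2)[OF that] by simp
      have cs: "continuous_map ?P euclideanreal
           (\<lambda>p. max 0 (2 * \<mu> k (snd p) - fst p / Suc d) / (2 - fst p) * of_bool (v \<in> \<sigma> k))"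
        if "k < m" for k
        using ne
        by (intro continuous_map_real_mult continuous_map_real_divide continuous_map_real_max
            continuous_map_diff c\<mu>[OF that] c2 cfst) auto
      have "continuous_map ?P euclideanreal (\<lambda>p. 2 / (2 - fst p) * base_part (snd p) v +
         (\<Sum>k<m. max 0 (2 * \<mu> k (snd p) - fst p / Suc d) / (2 - fst p) * of_bool (v \<in> \<sigma> k)))"
        using ne
        by (intro continuous_map_add continuous_map_sum cs continuous_map_real_mult
            continuous_map_real_divide c2 cbase[OF v]) auto
      then show "continuous_map ?S euclideanreal (\<lambda>p. E p v)"
        using v by (simp add: E_def continuous_map_from_subtopology)
    qed
    \<comment> \<open>On the seam the contraction \<open>H\<close> is at time 0, and
      \<open>2 / (2 - s)\<close> equals \<open>1 / (1 - a)\<close> because \<open>s = 2 a\<close>;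
      both formulas reduce to the radial projection.\<close>
    fix p assume p: "p \<in> topspace ?P" and eq: "2 * apex_part (snd p) = fst p"
    have "apex_part (snd p) < 1" using eq pD(2)[OF p] by linarith
    then have "H (fst p - 2 * apex_part (snd p), B p) = B p"
      using H0[OF BZ[OF p]] eq by simp
    also have "B p = E p"
    proof
      fix v
      have "max 0 (2 * \<mu> k (snd p) - fst p / Suc d) = 0" if "k < m" for k
      proof -
        have "Suc d * \<mu> k (snd p) \<le> apex_part (snd p)"
          by (rule apex_part_bounds(2)[OF pD(3)[OF p] that])
        then have "2 * \<mu> k (snd p) - fst p / Suc d \<le> 0"
          unfolding eq[symmetric] by (simp add: field_simps del: of_nat_Suc)
        then show ?thesis by simp
      qed
      then have "(\<Sum>k<m. max 0 (2 * \<mu> k (snd p) - fst p / Suc d) / (2 - fst p) * of_bool (v \<in> \<sigma> k)) = 0"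
        by (intro sum.neutral) simp
      moreover have "base_part (snd p) v / (1 - apex_part (snd p)) = 2 / (2 - fst p) * base_part (snd p) v"
        using pD(2)[OF p] unfolding eq[symmetric] by (simp add: field_simps)
      ultimately show "B p v = E p v"
        by (simp add: B_def E_def)
    qed
    finally show "H (fst p - 2 * apex_part (snd p), B p) = E p" .
  qed
  moreover have Gz: "G (s, f) = H (s, f)" if "0 \<le> s" "f \<in> topspace ?Z" for s f
  proof -
    have "f \<in> extensional V" using that(2) by (simp add: topspace_geometric_realization)
    then have "B (s, f) = f"
      using parts_base[OF that(2)] by (auto simp: B_def extensional_def)
    then show ?thesis
      using that(1) parts_base(1)[OF that(2)] by (simp add: G_def)
  qed
  moreover have "G (0, f) = f" if f: "f \<in> topspace ?X" for f
  proof (cases rule: base_cases[OF f])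
    case 1
    then show ?thesis using Gz[of 0 f] H0 by simp
  next
    case (2 k)
    note F = facetD[OF f 2] and Q = parts_facet[OF f 2]
    have "0 < apex_part f"
      unfolding Q(1) using F(2) by (simp del: of_nat_Suc)
    then have "G (0, f) = E (0, f)" by (simp add: G_def)
    also have "E (0, f) v = f v" for v
    proof (cases "v \<in> V")
      case True
      have "(\<Sum>k<m. max 0 (2 * \<mu> k f) / 2 * of_bool (v \<in> \<sigma> k)) = (\<Sum>k<m. \<mu> k f * of_bool (v \<in> \<sigma> k))"
        using apex_part_bounds(1)[OF f] by (intro sum.cong) auto
      then show ?thesis
        using True by (simp add: E_def base_part_def)
    next
      case False
      then show ?thesis
        using f by (auto simp: E_def topspace_geometric_realization extensional_def)
    qed
    then have "E (0, f) = f" by (rule ext)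
    finally show ?thesis .
  qed
  ultimately show ?thesis using that by blast
qed

lemma homotopy_equivalent_wedge_of_spheres:
  assumes con: "contractible_space (geometric_realization V Z)"
    and ne: "topspace (geometric_realization V Z) \<noteq> {}"
  shows "geometric_realization V K homotopy_equivalent_space wedge_of_spheres m (int d)"
proof -
  let ?I = "top_of_set {0..1::real}"
  let ?X = "geometric_realization V K" and ?Z = "geometric_realization V Z"
  obtain a H where H: "continuous_map (prod_topology ?I ?Z) ?Z H"
      "\<And>f. H (0, f) = f" "\<And>f. H (1, f) = a"
    using con unfolding contractible_space_def homotopic_with_def by auto
  obtain G where G: "continuous_map (prod_topology ?I ?X) ?X G"
      "\<And>f. f \<in> topspace ?X \<Longrightarrow> G (0, f) = f"
      "\<And>s f. \<lbrakk>0 \<le> s; f \<in> topspace ?Z\<rbrakk> \<Longrightarrow> G (s, f) = H (s, f)"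
    using contraction_extends[OF H(1)] H(2) by blast
  show ?thesis
  proof (rule homotopy_equivalent_space_by_collapse[where Z = "topspace ?Z"])
    show "compact_space ?X" by (rule compact_space_realization)
    show "Hausdorff_space (wedge_of_spheres m (int d))" by (rule Hausdorff_space_wedge_of_spheres)
    show "continuous_map ?X (wedge_of_spheres m (int d)) \<Phi>" by (rule continuous_map_\<Phi>)
    show "\<Phi> ` topspace ?X = topspace (wedge_of_spheres m (int d))" by (rule \<Phi>_surj[OF ne])
    show "f = g \<or> f \<in> topspace ?Z \<and> g \<in> topspace ?Z"
      if "f \<in> topspace ?X" "g \<in> topspace ?X" "\<Phi> f = \<Phi> g" for f g
      using \<Phi>_inj[OF that] \<Phi>_inj[OF that(2,1) that(3)[symmetric]] by blast
    show "\<Phi> f = \<Phi> g" if "f \<in> topspace ?Z" "g \<in> topspace ?Z" for f g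
      using \<Phi>_zero_iff topspace_Z_subset that by (metis subsetD)
    show "continuous_map (prod_topology ?I ?X) ?X G" by (rule G(1))
    show "G (0, f) = f" if "f \<in> topspace ?X" for f using G(2)[OF that] .
    show "G (s, f) \<in> topspace ?Z" if "0 \<le> s" "s \<le> 1" "f \<in> topspace ?Z" for s f
      using G(3)[OF that(1,3)] continuous_map_image_subset_topspace[OF H(1)] that by auto
    show "G (1, f) = G (1, g)" if "f \<in> topspace ?Z" "g \<in> topspace ?Z" for f g
      using G(3)[of 1] H(3) that by simp
  qed
qed

end

section \<open>The Whitehouse complex\<close>

lemma whitehouse_facesD:
  assumes "F \<in> whitehouse_faces n" "S \<in> F"
  shows "S \<subseteq> {2..n}" "finite S" "2 \<le> card S" "card S \<le> n - 2"
    and "\<And>T. T \<in> F \<Longrightarrow> S \<subseteq> T \<or> T \<subseteq> S \<or> S \<inter> T = {}"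
  using assms by (auto simp: whitehouse_faces_def whitehouse_vertices_def intro: finite_subset)

text \<open>Sharing the point \<open>2\<close> rules out disjointness, so the members containing
  \<open>2\<close> form a chain and size decides the direction of inclusion.\<close>

lemma whitehouse_nested:
  assumes "F \<in> whitehouse_faces n" "S \<in> F" "T \<in> F" "2 \<in> S" "2 \<in> T" "card S \<le> card T"
  shows "S \<subseteq> T"
  using whitehouse_facesD[OF assms(1,2)] whitehouse_facesD[OF assms(1,3)] assms
  by (metis IntI card_seteq empty_iff)

lemma finite_complex_whitehouse: "finite_complex (whitehouse_vertices n) (whitehouse_faces n)"
proof
  show "finite (whitehouse_vertices n)"
    unfolding whitehouse_vertices_def by (rule finite_subset[of _ "Pow {2..n}"]) auto
next
  fix F G assume F: "F \<in> whitehouse_faces n" and "G \<subseteq> F"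
  then have "G \<subseteq> whitehouse_vertices n"
    by (auto simp only: whitehouse_faces_def)
  moreover have "S \<subseteq> T \<or> T \<subseteq> S \<or> S \<inter> T = {}" if "S \<in> G" "T \<in> G" for S T
    using whitehouse_facesD(5)[OF F] \<open>G \<subseteq> F\<close> that by blast
  ultimately show "G \<in> whitehouse_faces n"
    by (simp add: whitehouse_faces_def)
qed (simp add: whitehouse_faces_def)

section \<open>Full faces, flags and orderings of \<open>{3..n}\<close>\<close>

definition full :: "nat \<Rightarrow> nat set set \<Rightarrow> bool" where
  "full n F \<longleftrightarrow> (\<forall>i\<in>{2..n - 2}. \<exists>S\<in>F. 2 \<in> S \<and> card S = i)"

text \<open>The indices \<open>0, ..., n - 4\<close> give the sizes \<open>2, ..., n - 2\<close>.
  The last entry of an ordering enters none of these sets, but it is forced as the one element left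
  over.\<close>

definition flag :: "nat list \<Rightarrow> nat \<Rightarrow> nat set" where
  "flag xs j = insert 2 (set (take (Suc j) xs))"

context
  fixes n :: nat and xs :: "nat list"
  assumes n: "4 \<le> n" and xs: "xs \<in> permutations_of_set {3..n}"
begin

lemma length_flag: "length xs = n - 2"
  using length_finite_permutations_of_set[OF xs] by simp

lemma card_flag: "j \<le> n - 4 \<Longrightarrow> card (flag xs j) = j + 2"
proof -
  assume j: "j \<le> n - 4"
  have "2 \<notin> set (take (Suc j) xs)"
    using permutations_of_setD[OF xs] set_take_subset[of "Suc j" xs] by auto
  moreover have "card (set (take (Suc j) xs)) = Suc j"
    using permutations_of_setD[OF xs] length_flag j n
    by (subst distinct_card) auto
  ultimately show ?thesis
    by (simp add: flag_def)
qed

lemma flag_mono: "i \<le> j \<Longrightarrow> flag xs i \<subseteq> flag xs j"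
  unfolding flag_def by (intro insert_mono set_take_subset_set_take) simp

lemma inj_on_flag: "inj_on (flag xs) {..n - 4}"
  by (rule inj_onI) (metis add_right_cancel atMost_iff card_flag)

lemma card_flag_image: "card (flag xs ` {..n - 4}) = n - 3"
  using n by (simp add: card_image inj_on_flag)

lemma flag_face: "flag xs ` {..n - 4} \<in> whitehouse_faces n"
proof -
  have "flag xs j \<in> whitehouse_vertices n" if "j \<le> n - 4" for j
  proof -
    have "set (take (Suc j) xs) \<subseteq> {3..n}"
      using permutations_of_setD[OF xs] set_take_subset[of "Suc j" xs] by simp
    then have "flag xs j \<subseteq> {2..n}"
      using n by (fastforce simp: flag_def)
    then show ?thesis
      using card_flag[OF that] that n by (auto simp: whitehouse_vertices_def)
  qed
  moreover have "flag xs i \<subseteq> flag xs j \<or> flag xs j \<subseteq> flag xs i" for i j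
    using flag_mono by (meson nat_le_linear)
  ultimately show ?thesis
    by (auto simp: whitehouse_faces_def)
qed

lemma full_flag: "full n (flag xs ` {..n - 4})"
  unfolding full_def
proof
  fix i assume "i \<in> {2..n - 2}"
  then have "i - 2 \<le> n - 4" "i - 2 + 2 = i" by auto
  then show "\<exists>S\<in>flag xs ` {..n - 4}. 2 \<in> S \<and> card S = i"
    using card_flag[of "i - 2"] by (intro bexI[of _ "flag xs (i - 2)"]) (auto simp: flag_def)
qed

end

text \<open>Size determines the index, so equal images mean equal flags term by term; the entries of
  the list are then the differences of consecutive prefixes.\<close>

lemma flag_image_inj:
  assumes n: "4 \<le> n" and xs: "xs \<in> permutations_of_set {3..n}" and ys: "ys \<in> permutations_of_set {3..n}"
    and eq: "flag xs ` {..n - 4} = flag ys ` {..n - 4}"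
  shows "xs = ys"
proof -
  have len: "length xs = n - 2" "length ys = n - 2"
    using length_flag[OF n xs] length_flag[OF n ys] by auto
  have sets: "set xs = {3..n}" "set ys = {3..n}" and dist: "distinct xs" "distinct ys"
    using permutations_of_setD[OF xs] permutations_of_setD[OF ys] by auto
  have fl: "flag xs j = flag ys j" if j: "j \<le> n - 4" for j
  proof -
    have "flag xs j \<in> flag ys ` {..n - 4}"
      using j unfolding eq[symmetric] by simp
    then obtain i where i: "i \<le> n - 4" "flag xs j = flag ys i" by auto
    then have "i = j"
      using card_flag[OF n xs j] card_flag[OF n ys i(1)] by simp
    with i show ?thesis by simp
  qed
  have take_eq: "set (take i xs) = set (take i ys)" if i: "i \<le> n - 2" for i
  proof -
    \<comment> \<open>The flag shows no prefix of length 0 or \<open>n - 2\<close>, but these agree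
      because both lists enumerate \<open>{3..n}\<close>.\<close>
    consider "i = 0" | j where "i = Suc j" "j \<le> n - 4" | "i = n - 2"
      using i n by (cases i) (auto, linarith)
    then show ?thesis
    proof cases
      case 2
      have "2 \<notin> set (take i xs)" "2 \<notin> set (take i ys)"
        using set_take_subset[of i xs] set_take_subset[of i ys] sets by auto
      then show ?thesis
        using fl[OF 2(2)] unfolding flag_def 2(1) by (metis insert_ident)
    next
      case 3
      then show ?thesis using len sets by simp
    qed simp
  qed
  show ?thesis
  proof (rule nth_equalityI)
    fix i assume i: "i < length xs"
    have "set (take (Suc i) zs) - set (take i zs) = {zs ! i}"
      if "distinct zs" "length zs = n - 2" for zs :: "nat list"
    proof -
      have "take (Suc i) zs = take i zs @ [zs ! i]"
        using i that len by (simp add: take_Suc_conv_app_nth)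
      moreover have "distinct (take (Suc i) zs)"
        using that by simp
      ultimately show ?thesis by auto
    qed
    from this[OF dist(1) len(1)] this[OF dist(2) len(2)] take_eq[of i] take_eq[of "Suc i"]
    show "xs ! i = ys ! i"
      using i len by simp
  qed (simp add: len)
qed

text \<open>The members containing \<open>2\<close> form a chain with one set of each size;
  consecutive sets differ by one element, and these elements in order are the permutation. A finest
  possible chain leaves no room for a member without \<open>2\<close>.\<close>

lemma full_face_is_flag:
  assumes n: "4 \<le> n" and F: "F \<in> whitehouse_faces n" and full: "full n F"
  obtains xs where "xs \<in> permutations_of_set {3..n}" "F = flag xs ` {..n - 4}"
proof -
  obtain S where S: "\<And>i. 2 \<le> i \<Longrightarrow> i \<le> n - 2 \<Longrightarrow> S i \<in> F \<and> 2 \<in> S i \<and> card (S i) = i"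
    using full unfolding full_def by (metis atLeastAtMost_iff)
  \<comment> \<open>The ends \<open>{2}\<close> and \<open>{2..n}\<close> are no vertices of the
    complex; adjoining them makes the chain start at size 1 and reach every element.\<close>
  define T where "T i = (if i = 1 then {2} else if i = n - 1 then {2..n} else S i)" for i
  have "n - 1 \<noteq> 1" using n by linarith
  then have T_top: "T (n - 1) = {2..n}" by (simp add: T_def)
  have TF: "T i \<in> F" if "2 \<le> i" "i \<le> n - 2" for i
    using that S n by (auto simp: T_def)
  have T: "2 \<in> T i" "card (T i) = i" "finite (T i)" "T i \<subseteq> {2..n}" if "1 \<le> i" "i \<le> n - 1" for i
  proof -
    have "i = 1 \<or> i = n - 1 \<or> 2 \<le> i \<and> i \<le> n - 2 \<and> i \<noteq> 1 \<and> i \<noteq> n - 1"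
      using that n by linarith
    then show "2 \<in> T i" "card (T i) = i" "finite (T i)" "T i \<subseteq> {2..n}"
      using S whitehouse_facesD(1,2)[OF F] n unfolding T_def by (auto split: if_splits)
  qed
  have sub: "T i \<subseteq> T (Suc i)" if i: "1 \<le> i" "Suc i \<le> n - 1" for i
  proof -
    consider "i = 1" | "Suc i = n - 1" | "2 \<le> i" "Suc i \<le> n - 2"
      using i by linarith
    then show ?thesis
    proof cases
      case 1
      then show ?thesis using T(1)[of "Suc i"] i by (simp add: T_def)
    next
      case 2
      then have "T (Suc i) = {2..n}" by (simp only: T_top)
      then show ?thesis using T(4)[of i] i by simp
    next
      case 3
      show ?thesis
        by (rule whitehouse_nested[OF F]) (use 3 TF T[of i] T[of "Suc i"] i in auto)
    qed
  qed
  have "\<exists>x. x \<notin> T (Suc i) \<and> T (Suc (Suc i)) = insert x (T (Suc i))" if i: "i < n - 2" for i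
  proof -
    have le: "1 \<le> Suc i" "Suc i \<le> n - 1" "1 \<le> Suc (Suc i)" "Suc (Suc i) \<le> n - 1"
      using i by auto
    have "card (T (Suc (Suc i)) - T (Suc i)) = 1"
      using card_Diff_subset[OF T(3)[OF le(1,2)] sub[OF le(1,4)]] T(2)[OF le(1,2)] T(2)[OF le(3,4)]
      by simp
    then obtain x where "T (Suc (Suc i)) - T (Suc i) = {x}"
      by (auto simp: card_1_singleton_iff)
    then have "x \<notin> T (Suc i) \<and> T (Suc (Suc i)) = insert x (T (Suc i))"
      using sub[OF le(1,4)] by blast
    then show ?thesis ..
  qed
  then obtain x where x: "\<And>i. i < n - 2 \<Longrightarrow> x i \<notin> T (Suc i)"
      "\<And>i. i < n - 2 \<Longrightarrow> T (Suc (Suc i)) = insert (x i) (T (Suc i))"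
    by metis
  define xs where "xs = map x [0..<n - 2]"
  have T_take: "insert 2 (set (take i xs)) = T (Suc i)" if "i \<le> n - 2" for i
    using that
  proof (induction i)
    case 0
    then show ?case by (simp add: T_def)
  next
    case (Suc i)
    then have "take (Suc i) xs = take i xs @ [x i]"
      by (simp add: take_Suc_conv_app_nth xs_def)
    then show ?case
      using Suc x(2)[of i] by auto
  qed
  have "insert 2 (set xs) = T (n - 1)"
    using T_take[of "n - 2"] n by (simp add: xs_def Suc_diff_Suc numeral_2_eq_2)
  then have "insert 2 (set xs) = {2..n}"
    by (simp only: T_top)
  moreover have "2 \<notin> set xs"
    using x(1) T(1) by (fastforce simp: xs_def)
  ultimately have "set xs = {2..n} - {2}"
    by blast
  also have "\<dots> = {3..n}" by auto
  finally have set: "set xs = {3..n}" .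
  have "distinct xs"
    by (rule card_distinct) (use set n in \<open>simp add: xs_def\<close>)
  with set have perm: "xs \<in> permutations_of_set {3..n}"
    by (intro permutations_of_setI)
  have fl: "flag xs j = T (j + 2)" if "j \<le> n - 4" for j
    using T_take[of "Suc j"] that n by (simp add: flag_def)
  have "F = flag xs ` {..n - 4}"
  proof (intro equalityI subsetI)
    fix X assume "X \<in> flag xs ` {..n - 4}"
    then obtain j where "j \<le> n - 4" "X = T (j + 2)" using fl by auto
    then show "X \<in> F" using TF[of "j + 2"] n by simp
  next
    fix X assume X: "X \<in> F"
    note W = whitehouse_facesD[OF F X]
    show "X \<in> flag xs ` {..n - 4}"
    proof (cases "2 \<in> X")
      case True
      have c: "2 \<le> card X" "card X \<le> n - 2" "1 \<le> card X" "card X \<le> n - 1"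
        using W by auto
      have "X = T (card X)"
        using whitehouse_nested[OF F X TF[OF c(1,2)] True T(1)[OF c(3,4)]]
          whitehouse_nested[OF F TF[OF c(1,2)] X T(1)[OF c(3,4)] True] T(2)[OF c(3,4)] by auto
      moreover have "card X - 2 \<le> n - 4" "card X - 2 + 2 = card X"
        using c by auto
      ultimately have "X = flag xs (card X - 2)" "card X - 2 \<in> {..n - 4}"
        using fl[of "card X - 2"] by auto
      then show ?thesis by (rule image_eqI)
    next
      case False
      \<comment> \<open>Let \<open>T i\<close> be the first set of the chain that meets
        \<open>X\<close>. It adds one point to its predecessor, so it meets \<open>X\<close> in one
        point only. But \<open>2\<close> lies in \<open>T i\<close> and not in \<open>X\<close>, so
        compatibility leaves only \<open>X \<subseteq> T i\<close>, and \<open>X\<close> would have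
        at most one element.\<close>
      define i where "i = (LEAST i. 1 \<le> i \<and> X \<inter> T i \<noteq> {})"
      have "X \<inter> T (n - 1) \<noteq> {}"
        unfolding T_top Int_absorb2[OF W(1)] using W(3) by auto
      then have ex: "1 \<le> n - 1 \<and> X \<inter> T (n - 1) \<noteq> {}" using n by simp
      have "1 \<le> i \<and> X \<inter> T i \<noteq> {}"
        unfolding i_def by (rule LeastI, rule ex)
      moreover have "i \<le> n - 1"
        unfolding i_def by (rule Least_le, rule ex)
      ultimately have i: "1 \<le> i" "X \<inter> T i \<noteq> {}" "i \<le> n - 1"
        by blast+
      have "T 1 = {2}" by (simp add: T_def)
      then have "i \<noteq> 1" using i(2) False by auto
      define j where "j = i - 2"
      have j: "i = Suc (Suc j)"
        using i(1) \<open>i \<noteq> 1\<close> unfolding j_def by linarith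
      have "X \<inter> T (Suc j) = {}"
        using not_less_Least[of "Suc j" "\<lambda>i. 1 \<le> i \<and> X \<inter> T i \<noteq> {}"] j unfolding i_def[symmetric] by auto
      then have "X \<inter> T i \<subseteq> {x j}"
        using x(2)[of j] i(3) j by auto
      then have one: "card (X \<inter> T i) \<le> 1"
        using card_mono[of "{x j}" "X \<inter> T i"] by simp
      have "X \<subseteq> T i"
      proof (cases "i = n - 1")
        case True
        then show ?thesis using W(1) by (simp only: T_top)
      next
        case ne: False
        then have "T i \<in> F" using TF[of i] i(3) j by auto
        then show ?thesis
          using W(5)[of "T i"] i(2) False T(1)[OF i(1,3)] by auto
      qed
      then have "card X \<le> 1" using one by (simp add: Int_absorb2)
      then show ?thesis using W(3) by simp
    qed
  qed
  with perm show ?thesis by (rule that)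
qed

section \<open>The matching on the faces that are not full\<close>

text \<open>A face that is not full contains sets \<open>S \<ni> 2\<close> of the sizes \<open>2, \<dots>, i - 1\<close> but not of size \<open>i\<close>.
  The apex is the difference of the next larger set (or \<open>{2..n}\<close>) and the preceding one (or \<open>{2}\<close>).\<close>

definition apex :: "nat \<Rightarrow> nat set set \<Rightarrow> nat set" where
  "apex n c = (let i = LEAST i. 2 \<le> i \<and> (\<forall>S\<in>c. card S \<noteq> i) in
     ({2..n} \<inter> \<Inter>{S \<in> c. i < card S}) - insert 2 (\<Union>{S \<in> c. card S < i}))"

text \<open>\<open>P\<close> and \<open>R\<close> are the neighbours of the first gap in the chain,
  with \<open>{2}\<close> and \<open>{2..n}\<close> as default ends. The gap makes
  \<open>R - P\<close> large enough to be a vertex, and no member of \<open>F\<close> can cut across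
  it.\<close>

lemma apex_face:
  assumes n: "4 \<le> n" and F: "F \<in> whitehouse_faces n" and nf: "\<not> full n F"
  defines "q \<equiv> apex n {S \<in> F. 2 \<in> S}"
  shows "2 \<notin> q" "insert q F \<in> whitehouse_faces n"
proof -
  define c where "c = {S \<in> F. 2 \<in> S}"
  define i where "i = (LEAST i. 2 \<le> i \<and> (\<forall>S\<in>c. card S \<noteq> i))"
  define R where "R = {2..n} \<inter> \<Inter>{S \<in> c. i < card S}"
  define P where "P = insert 2 (\<Union>{S \<in> c. card S < i})"
  have q: "q = R - P"
    unfolding q_def apex_def Let_def R_def P_def i_def c_def by (rule refl)
  show q2: "2 \<notin> q" by (simp add: q P_def)
  obtain i' where i': "2 \<le> i'" "i' \<le> n - 2" "\<forall>S\<in>c. card S \<noteq> i'"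
    using nf by (auto simp: full_def c_def)
  have i: "2 \<le> i" "\<And>S. S \<in> c \<Longrightarrow> card S \<noteq> i" "i \<le> n - 2"
    using LeastI[of "\<lambda>i. 2 \<le> i \<and> (\<forall>S\<in>c. card S \<noteq> i)" i'] Least_le[of "\<lambda>i. 2 \<le> i \<and> (\<forall>S\<in>c. card S \<noteq> i)" i']
      i' unfolding i_def[symmetric] by auto
  have cF: "c \<subseteq> F" by (auto simp: c_def)
  have c2: "2 \<in> S" if "S \<in> c" for S using that by (simp add: c_def)
  note W = whitehouse_facesD[OF F]
  have nest: "S \<subseteq> T" if "S \<in> c" "T \<in> c" "card S \<le> card T" for S T
    using whitehouse_nested[OF F] that cF c2 by blast
  \<comment> \<open>By minimality of \<open>i\<close> the size \<open>i - 1\<close> occurs in the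
    chain, unless it is 1 and is represented by \<open>{2}\<close>.\<close>
  have P: "card P = i - 1 \<and> (P = {2} \<or> P \<in> c)"
  proof (cases "i = 2")
    case True
    have "\<not> card S < i" if "S \<in> c" for S
      using W(3)[of S] that cF True by auto
    then have e: "{S \<in> c. card S < i} = {}" by blast
    have "P = {2}" unfolding P_def e by simp
    then show ?thesis using True by simp
  next
    case False
    then have "2 \<le> i - 1" "i - 1 < i" using i(1) by auto
    then obtain S where S: "S \<in> c" "card S = i - 1"
      using not_less_Least[of "i - 1" "\<lambda>i. 2 \<le> i \<and> (\<forall>S\<in>c. card S \<noteq> i)"] unfolding i_def[symmetric] by auto
    have "T \<subseteq> S" if "T \<in> c" "card T < i" for T
      by (rule nest) (use that S in auto)
    then have "P = S"
      using S c2 i(1) by (auto simp: P_def)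
    then show ?thesis using S by simp
  qed
  have R: "i < card R \<and> finite R \<and> (R = {2..n} \<or> R \<in> c)"
  proof (cases "{S \<in> c. i < card S} = {}")
    case True
    then have "R = {2..n}" by (simp only: R_def) simp
    then show ?thesis using i(3) n by simp
  next
    case False
    then obtain S where S: "S \<in> c" "i < card S" "\<And>T. T \<in> c \<Longrightarrow> i < card T \<Longrightarrow> card S \<le> card T"
      using ex_has_least_nat[of "\<lambda>S. S \<in> c \<and> i < card S" _ card] by blast
    have "S \<subseteq> T" if "T \<in> c" "i < card T" for T
      using nest S that by blast
    moreover have "S \<subseteq> {2..n}" "finite S"
      using W(1,2)[of S] S(1) cF by auto
    ultimately have "R = S"
      using S by (auto simp: R_def)
    then show ?thesis using S \<open>finite S\<close> by simp
  qed
  have Pf: "finite P"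
    using P W(2) cF by auto
  \<comment> \<open>\<open>P\<close> has \<open>i - 1\<close> elements and \<open>R\<close> at least
    \<open>i + 1\<close>, so two elements remain, the least that a vertex allows.\<close>
  have "card R \<le> card (R - P) + card P"
    using R Pf by (metis card_Un_le card_mono finite_Diff finite_UnI Un_Diff_cancel2 Un_upper1 order_trans)
  then have "2 \<le> card q"
    using P R i(1) unfolding q by linarith
  moreover have qs: "q \<subseteq> {3..n}"
  proof
    fix y assume y: "y \<in> q"
    then have "y \<in> {2..n}" "y \<noteq> 2" using q2 by (auto simp: q R_def)
    then show "y \<in> {3..n}" by auto
  qed
  moreover have "card q \<le> n - 2"
    using card_mono[OF _ qs] by simp
  ultimately have qV: "q \<in> whitehouse_vertices n"
    unfolding whitehouse_vertices_def by auto
  \<comment> \<open>A member with \<open>2\<close> lies inside \<open>P\<close> or contains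
    \<open>R\<close>. A member without \<open>2\<close> is disjoint from or inside each of
    \<open>P\<close> and \<open>R\<close>, which places it inside \<open>R - P\<close> or apart from
    it.\<close>
  have "q \<subseteq> T \<or> T \<subseteq> q \<or> q \<inter> T = {}" if T: "T \<in> F" for T
  proof (cases "2 \<in> T")
    case True
    then have Tc: "T \<in> c" using T by (simp add: c_def)
    show ?thesis
    proof (cases "card T < i")
      case True
      then have "T \<subseteq> P" using Tc by (auto simp: P_def)
      then show ?thesis by (auto simp: q)
    next
      case False
      then have "R \<subseteq> T" using Tc i(2)[OF Tc] by (auto simp: R_def)
      then show ?thesis by (auto simp: q)
    qed
  next
    case False
    have "P \<inter> T = {} \<or> T \<subseteq> P"
      using P W(5)[OF T, of P] cF c2 False by auto
    moreover have "R \<inter> T = {} \<or> T \<subseteq> R"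
      using R W(1)[OF T] W(5)[OF T, of R] cF c2 False by auto
    ultimately show ?thesis unfolding q by blast
  qed
  then show "insert q F \<in> whitehouse_faces n"
    using F qV unfolding whitehouse_faces_def by blast
qed

text \<open>Fullness sees only the members containing \<open>2\<close>. The apex avoids
  \<open>2\<close>, so matched faces stay together among those that are not full.\<close>

lemma full_cong:
  assumes "{S \<in> F. 2 \<in> S} = {S \<in> G. 2 \<in> S}"
  shows "full n F = full n G"
proof -
  have "full n H \<longleftrightarrow> (\<forall>i\<in>{2..n - 2}. \<exists>S\<in>{S \<in> H. 2 \<in> S}. card S = i)" for H
    by (simp add: full_def Bex_def conj_assoc)
  then show ?thesis
    by (simp only: assms)
qed

theorem mainTheorem12:
  fixes n :: nat
  assumes "n \<ge> 3"
  shows "(geometric_realization (whitehouse_vertices n) (whitehouse_faces n))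
           homotopy_equivalent_space
           (wedge_of_spheres (fact (n - 2)) (int n - 4))"
proof (cases "n = 3")
  case True
  \<comment> \<open>Without vertices the coordinate sum is 0 and never 1, so the realization is
    empty, as is the wedge in negative dimension.\<close>
  have "whitehouse_vertices n = {}"
    by (auto simp: whitehouse_vertices_def True)
  then have "topspace (geometric_realization (whitehouse_vertices n) (whitehouse_faces n)) = {}"
    by (simp add: topspace_geometric_realization)
  moreover have "topspace (wedge_of_spheres (fact (n - 2)) (int n - 4)) = {}"
    by (simp add: wedge_of_spheres_def True)
  ultimately show ?thesis
    by (metis homeomorphic_empty_space_eq homeomorphic_imp_homotopy_equivalent_space null_topspace_iff_trivial)
next
  case False
  then have n: "4 \<le> n" using assms by simp
  let ?V = "whitehouse_vertices n" and ?K = "whitehouse_faces n" and ?L = "permutations_of_set {3..n}"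
  have "card ?L = fact (n - 2)" "finite ?L"
    by (simp_all add: numeral_eq_Suc)
  moreover from this obtain x where "bij_betw x {0..<card ?L} ?L"
    using ex_bij_betw_nat_finite by blast
  ultimately have x: "bij_betw x {..<fact (n - 2)} ?L"
    by (simp add: atLeast0LessThan)
  have xL: "x k \<in> ?L" if "k < fact (n - 2)" for k
    using x that by (auto simp: bij_betw_def)
  interpret finite_complex ?V ?K by (rule finite_complex_whitehouse)
  interpret complex_with_facets ?V ?K "\<lambda>k. flag (x k)" "fact (n - 2)" "n - 4"
  proof
    fix k :: nat assume k: "k < fact (n - 2)"
    show "inj_on (flag (x k)) {..n - 4}" by (rule inj_on_flag[OF n xL[OF k]])
    show "flag (x k) ` {..n - 4} \<in> ?K" by (rule flag_face[OF n xL[OF k]])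
    fix F assume F: "F \<in> ?K" and sub: "flag (x k) ` {..n - 4} \<subseteq> F"
    \<comment> \<open>A face above a flag is full and thus itself the image of a flag; both have
      \<open>n - 3\<close> members, so the inclusion is an equality.\<close>
    have "full n F"
      using full_flag[OF n xL[OF k]] sub unfolding full_def by blast
    then obtain ys where "ys \<in> ?L" "F = flag ys ` {..n - 4}"
      by (rule full_face_is_flag[OF n F])
    then have "card F = card (flag (x k) ` {..n - 4})"
      using card_flag_image[OF n] xL[OF k] by simp
    then show "F = flag (x k) ` {..n - 4}"
      using sub finite_face[OF F] by (metis card_subset_eq)
  next
    show "inj_on (\<lambda>k. flag (x k) ` {..n - 4}) {..<fact (n - 2)}"
    proof (rule inj_onI)
      fix k l assume kl: "k \<in> {..<fact (n - 2)}" "l \<in> {..<fact (n - 2)}"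
        and "flag (x k) ` {..n - 4} = flag (x l) ` {..n - 4}"
      then have "x k = x l"
        using flag_image_inj[OF n xL xL] by simp
      then show "k = l"
        using x kl by (auto simp: bij_betw_def inj_on_def)
    qed
  qed
  have Z: "Z = {F \<in> ?K. \<not> full n F}"
  proof -
    have "(\<exists>k<fact (n - 2). F = flag (x k) ` {..n - 4}) \<longleftrightarrow> full n F" if F: "F \<in> ?K" for F
    proof
      assume "full n F"
      then obtain ys where "ys \<in> ?L" "F = flag ys ` {..n - 4}"
        by (rule full_face_is_flag[OF n F])
      then show "\<exists>k<fact (n - 2). F = flag (x k) ` {..n - 4}"
        using x unfolding bij_betw_def by (metis imageE lessThan_iff)
    qed (use full_flag[OF n xL] in blast)
    then show ?thesis
      unfolding Z_def \<sigma>_def by blast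
  qed
  interpret Z: finite_complex ?V Z by (rule finite_complex_Z)
  define A where "A = {S \<in> ?V. 2 \<in> S}"
  have FA: "F \<inter> A = {S \<in> F. 2 \<in> S}" if "F \<in> Z" for F
    using Z.face_subset[OF that] by (auto simp: A_def)
  have ap: "2 \<notin> apex n (F \<inter> A)" "insert (apex n (F \<inter> A)) F \<in> ?K" if "F \<in> Z" for F
    using apex_face[OF n, of F] that unfolding FA[OF that] Z by auto
  have apZ: "insert (apex n (F \<inter> A)) F \<in> Z" if "F \<in> Z" for F
  proof -
    have "full n (insert (apex n (F \<inter> A)) F) = full n F"
      using ap(1)[OF that] by (intro full_cong) auto
    then show ?thesis
      using ap(2)[OF that] that by (simp add: Z)
  qed
  \<comment> \<open>For \<open>n \<ge> 4\<close> fullness demands at least a set of size 2. The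
    empty face is matched with the single vertex \<open>{3..n}\<close>, which is the apex of the
    cone at the bottom of the filtration.\<close>
  have "\<not> full n {}"
    using n by (auto simp: full_def)
  moreover have "{} \<in> ?K"
    by (simp add: whitehouse_faces_def)
  ultimately have e: "{} \<in> Z"
    by (simp add: Z)
  have "contractible_space (geometric_realization ?V Z)"
    by (rule Z.contractible_by_matching[of "apex n" A]) (use apZ ap(1) e in \<open>auto simp: A_def\<close>)
  moreover have "topspace (geometric_realization ?V Z) \<noteq> {}"
    by (rule Z.realization_nonempty) (use apZ[OF e] in simp)
  ultimately have "geometric_realization ?V ?K homotopy_equivalent_space
      wedge_of_spheres (fact (n - 2)) (int (n - 4))"
    by (rule homotopy_equivalent_wedge_of_spheres)
  moreover have "int (n - 4) = int n - 4" using n by simp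
  ultimately show ?thesis by simp
qed

end
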